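(* There exists a bounded simply connected domain $D\subset \mathbb{C}$ which has the Denjoy-Wolff Property but whose boundary is not locally connected. In particular, any Riemann map $h:\mathbb{D}\to D$ does not extend continuously to $\partial \mathbb{D}$, but has $H$-limit (and hence non-tangential limit) at every point of $\partial \mathbb{D}$.
   Context: $\mathbb{D}$ is the open unit disc, $\mathbb{C}_\infty$ the Riemann sphere. For a domain $\Omega\subset\mathbb{C}$, $\partial\Omega$ is its boundary in $\mathbb{C}_\infty$ (the Euclidean boundary if $\Omega$ is bounded). A Riemann map of $\Omega$ is a biholomorphism $h:\mathbb{D}\to\Omega$. A simply connected domain $\Omega$ has the Denjoy-Wolff Property if for every holomorphic $f:\Omega\to\Omega$ without fixed points in $\Omega$ there is $\tau\in\partial\Omega$ such that the iterates $f^{\circ n}$ converge to $\tau$ uniformly on compacta of $\Omega$ (as maps into $\mathbb{C}_\infty$). For $\sigma\in\partial\mathbb{D}$ and $R>0$ let $E(\sigma,R)=\{z\in\mathbb{D}: \frac{|\sigma-z|^2}{1-|z|^2}<R\}$. A function $h:\mathbb{D}\to\mathbb{C}$ has $H$-limit $L\in\mathbb{C}_\infty$ at $\sigma\in\partial\mathbb{D}$ if for every sequence $\{z_n\}\subset\mathbb{D}$ converging to $\sigma$ that is eventually contained in $E(\sigma,R)$ for some $R>0$, the sequence $\{h(z_n)\}$ converges to $L$. *)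

theory Defs
  imports "HOL-Complex_Analysis.Complex_Analysis"
begin

text \<open>The Riemann sphere is the one-point compactification of the complex plane; the point at
  infinity is \<open>None\<close>.\<close>

abbreviation riemann_sphere :: "complex option topology" where
  "riemann_sphere \<equiv> Alexandroff_compactification euclidean"

text \<open>The chordal distance, which makes uniform convergence on the sphere meaningful. It induces the
  topology of \<^term>\<open>riemann_sphere\<close>, see \<open>openin_riemann_sphere_chordal\<close> below.\<close>

fun chordal_dist :: "complex option \<Rightarrow> complex option \<Rightarrow> real" where
  "chordal_dist (Some z) (Some w) =
     2 * cmod (z - w) / (sqrt (1 + (cmod z)\<^sup>2) * sqrt (1 + (cmod w)\<^sup>2))"
| "chordal_dist (Some z) None = 2 / sqrt (1 + (cmod z)\<^sup>2)"
| "chordal_dist None (Some w) = 2 / sqrt (1 + (cmod w)\<^sup>2)"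
| "chordal_dist None None = 0"

definition riemann_map :: "(complex \<Rightarrow> complex) \<Rightarrow> complex set \<Rightarrow> bool" where
  "riemann_map h \<Omega> \<longleftrightarrow>
     h holomorphic_on ball 0 1 \<and> bij_betw h (ball 0 1) \<Omega> \<and>
     inv_into (ball 0 1) h holomorphic_on \<Omega>"

text \<open>To be used for simply connected domains \<open>\<Omega>\<close>. The point \<open>\<tau>\<close> ranges over the boundary of
  \<open>\<Omega>\<close> in the sphere, so \<open>\<tau> = None\<close> is possible when \<open>\<Omega>\<close> is unbounded.\<close>

definition denjoy_wolff_property :: "complex set \<Rightarrow> bool" where
  "denjoy_wolff_property \<Omega> \<longleftrightarrow>
     (\<forall>f. f holomorphic_on \<Omega> \<and> f ` \<Omega> \<subseteq> \<Omega> \<and> (\<forall>z\<in>\<Omega>. f z \<noteq> z) \<longrightarrow>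
        (\<exists>\<tau> \<in> riemann_sphere frontier_of (Some ` \<Omega>).
           \<forall>K. compact K \<and> K \<subseteq> \<Omega> \<longrightarrow>
             (\<forall>\<epsilon>>0. \<forall>\<^sub>F n in sequentially. \<forall>z\<in>K. chordal_dist (Some ((f ^^ n) z)) \<tau> < \<epsilon>)))"

definition horodisc :: "complex \<Rightarrow> real \<Rightarrow> complex set" where
  "horodisc \<sigma> R = {z \<in> ball 0 1. (cmod (\<sigma> - z))\<^sup>2 / (1 - (cmod z)\<^sup>2) < R}"

definition has_H_limit :: "(complex \<Rightarrow> complex) \<Rightarrow> complex option \<Rightarrow> complex \<Rightarrow> bool" where
  "has_H_limit h L \<sigma> \<longleftrightarrow>
     (\<forall>z :: nat \<Rightarrow> complex.
        (\<forall>n. z n \<in> ball 0 1) \<and> z \<longlonglongrightarrow> \<sigma> \<and>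
        (\<exists>R>0. \<forall>\<^sub>F n in sequentially. z n \<in> horodisc \<sigma> R) \<longrightarrow>
        limitin riemann_sphere (\<lambda>n. Some (h (z n))) L sequentially)"

definition stolz_region :: "complex \<Rightarrow> real \<Rightarrow> complex set" where
  "stolz_region \<sigma> M = {z \<in> ball 0 1. cmod (\<sigma> - z) < M * (1 - cmod z)}"

definition has_nontangential_limit ::
  "(complex \<Rightarrow> complex) \<Rightarrow> complex option \<Rightarrow> complex \<Rightarrow> bool" where
  "has_nontangential_limit h L \<sigma> \<longleftrightarrow>
     (\<forall>M>1. limitin riemann_sphere (\<lambda>z. Some (h z)) L (at \<sigma> within stolz_region \<sigma> M))"

lemma chordal_dist_far:
  assumes r: "r > 0" and t: "cmod (z - w) \<ge> r"
  shows "chordal_dist (Some z) (Some w) \<ge> 2 / (sqrt (1 + (cmod z)\<^sup>2) * ((1 + cmod z) / r + 1))"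
proof -
  define s where "s = cmod (z - w)"
  have s: "s \<ge> r" "s > 0" using r t by (auto simp: s_def)
  have w: "cmod w \<le> cmod z + s"
    unfolding s_def by (metis norm_minus_commute norm_triangle_sub)
  have "sqrt (1 + (cmod w)\<^sup>2) \<le> 1 + cmod w"
    by (rule real_le_lsqrt) (auto simp: power2_eq_square algebra_simps)
  also have "\<dots> \<le> 1 + cmod z + s" using w by simp
  also have "\<dots> \<le> s * ((1 + cmod z) / r + 1)"
  proof -
    have "(1 + cmod z) * r \<le> (1 + cmod z) * s" using s by (intro mult_left_mono) auto
    then have "1 + cmod z \<le> s * ((1 + cmod z) / r)" using r by (simp add: field_simps)
    then show ?thesis by (simp add: distrib_left)
  qed
  finally have b: "sqrt (1 + (cmod w)\<^sup>2) \<le> s * ((1 + cmod z) / r + 1)" .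
  have p: "sqrt (1 + (cmod z)\<^sup>2) > 0" "sqrt (1 + (cmod w)\<^sup>2) > 0"
    by (auto simp: add_pos_nonneg)
  have c: "(1 + cmod z) / r + 1 > 0" using r by (simp add: add_pos_nonneg add_nonneg_pos)
  have "2 / (sqrt (1 + (cmod z)\<^sup>2) * ((1 + cmod z) / r + 1))
      = 2 * s / (sqrt (1 + (cmod z)\<^sup>2) * (s * ((1 + cmod z) / r + 1)))"
    using s by simp
  also have "\<dots> \<le> 2 * s / (sqrt (1 + (cmod z)\<^sup>2) * sqrt (1 + (cmod w)\<^sup>2))"
    using b p s c by (intro divide_left_mono mult_left_mono mult_pos_pos) auto
  finally show ?thesis by (simp add: s_def)
qed

lemma chordal_dist_le: "chordal_dist (Some z) (Some w) \<le> 2 * cmod (z - w)"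
proof -
  have "1 * 1 \<le> sqrt (1 + (cmod z)\<^sup>2) * sqrt (1 + (cmod w)\<^sup>2)"
    by (intro mult_mono) auto
  then have "2 * cmod (z - w) / (sqrt (1 + (cmod z)\<^sup>2) * sqrt (1 + (cmod w)\<^sup>2))
     \<le> 2 * cmod (z - w) / 1"
    by (intro divide_left_mono) auto
  then show ?thesis by simp
qed

lemma openin_riemann_sphere_chordal:
  "openin riemann_sphere U \<longleftrightarrow>
     (\<forall>p\<in>U. \<exists>\<epsilon>>0. \<forall>q. chordal_dist p q < \<epsilon> \<longrightarrow> q \<in> U)"
proof
  assume U: "openin riemann_sphere U"
  show "\<forall>p\<in>U. \<exists>\<epsilon>>0. \<forall>q. chordal_dist p q < \<epsilon> \<longrightarrow> q \<in> U"
  proof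
    fix p assume p: "p \<in> U"
    show "\<exists>\<epsilon>>0. \<forall>q. chordal_dist p q < \<epsilon> \<longrightarrow> q \<in> U"
    proof (cases p)
      case None
      with p U obtain C where C: "compact C" "U = insert None (Some ` (- C))"
        by (auto simp: openin_Alexandroff_compactification Compl_eq_Diff_UNIV)
      obtain B where B: "B > 0" "\<And>z. z \<in> C \<Longrightarrow> cmod z \<le> B"
        using compact_imp_bounded[OF C(1)] by (auto simp: bounded_pos)
      show ?thesis
      proof (intro exI[of _ "2 / sqrt (1 + B\<^sup>2)"] conjI allI impI)
        show "2 / sqrt (1 + B\<^sup>2) > 0" by (simp add: add_pos_nonneg)
        fix q assume q: "chordal_dist p q < 2 / sqrt (1 + B\<^sup>2)"
        show "q \<in> U"
        proof (cases q)
          case (Some w)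
          have "w \<notin> C"
          proof
            assume "w \<in> C"
            then have "(cmod w)\<^sup>2 \<le> B\<^sup>2" using B by (simp add: power_mono)
            then have "2 / sqrt (1 + B\<^sup>2) \<le> 2 / sqrt (1 + (cmod w)\<^sup>2)"
              by (intro divide_left_mono mult_pos_pos) (auto simp: add_pos_nonneg)
            then show False using q Some None by simp
          qed
          then show ?thesis using C Some by auto
        qed (use C in auto)
      qed
    next
      case (Some z)
      have "open {w. Some w \<in> U}"
        using U by (auto simp: openin_Alexandroff_compactification image_iff
            intro: open_Compl[unfolded Compl_eq])
      moreover have "z \<in> {w. Some w \<in> U}" using p Some by simp
      ultimately obtain r where r: "r > 0" "ball z r \<subseteq> {w. Some w \<in> U}"
        using openE by blast
      define e where "e = 2 / (sqrt (1 + (cmod z)\<^sup>2) * ((1 + cmod z) / r + 1))"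
      have c: "(1 + cmod z) / r + 1 \<ge> 1" using r by simp
      have s: "sqrt (1 + (cmod z)\<^sup>2) > 0" by (simp add: add_pos_nonneg)
      have e: "e > 0" unfolding e_def using c s by (intro divide_pos_pos mult_pos_pos) auto
      have "sqrt (1 + (cmod z)\<^sup>2) * 1 \<le> sqrt (1 + (cmod z)\<^sup>2) * ((1 + cmod z) / r + 1)"
        using c s by (intro mult_left_mono) auto
      then have e2: "e \<le> 2 / sqrt (1 + (cmod z)\<^sup>2)"
        unfolding e_def using s by (intro divide_left_mono mult_pos_pos) auto
      show ?thesis
      proof (intro exI[of _ e] conjI allI impI e)
        fix q assume q: "chordal_dist p q < e"
        show "q \<in> U"
        proof (cases q)
          case None
          then show ?thesis using q Some e2 by simp
        next
          case (Some w)
          have "cmod (z - w) < r"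
            using chordal_dist_far[OF r(1), of z w] q Some \<open>p = Some z\<close>
            by (force simp: e_def simp del: chordal_dist.simps)
          then show ?thesis using r Some by (auto simp: dist_norm subset_iff)
        qed
      qed
    qed
  qed
next
  assume R: "\<forall>p\<in>U. \<exists>\<epsilon>>0. \<forall>q. chordal_dist p q < \<epsilon> \<longrightarrow> q \<in> U"
  define V where "V = {z. Some z \<in> U}"
  have V: "open V"
    unfolding open_dist
  proof
    fix z assume "z \<in> V"
    then obtain e where e: "e > 0" "\<And>q. chordal_dist (Some z) q < e \<Longrightarrow> q \<in> U"
      using R unfolding V_def by blast
    have "w \<in> V" if "dist w z < e / 2" for w
    proof -
      have "chordal_dist (Some z) (Some w) < e"
        using chordal_dist_le[of z w] that by (simp add: dist_norm norm_minus_commute del: chordal_dist.simps)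
      then show ?thesis using e by (simp add: V_def del: chordal_dist.simps)
    qed
    then show "\<exists>e>0. \<forall>y. dist y z < e \<longrightarrow> y \<in> V"
      using e by (intro exI[of _ "e / 2"]) auto
  qed
  show "openin riemann_sphere U"
  proof (cases "None \<in> U")
    case False
    then have "U = Some ` V"
      by (auto simp: V_def image_iff) (metis option.exhaust)
    then show ?thesis using V by simp
  next
    case True
    then obtain e where e: "e > 0" "\<And>q. chordal_dist None q < e \<Longrightarrow> q \<in> U"
      using R by blast
    have "cmod w \<le> 2 / e" if "w \<in> - V" for w
    proof (rule ccontr)
      assume "\<not> cmod w \<le> 2 / e"
      then have w: "cmod w > 2 / e" by simp
      have "cmod w < sqrt (1 + (cmod w)\<^sup>2)" by (rule real_less_rsqrt) simp
      with w have "2 / e < sqrt (1 + (cmod w)\<^sup>2)" by simp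
      then have "2 / sqrt (1 + (cmod w)\<^sup>2) < e"
        using e(1) by (simp add: field_simps add_pos_nonneg)
      then show False using e(2)[of "Some w"] that by (simp add: V_def)
    qed
    then have "bounded (- V)" unfolding bounded_iff by blast
    then have "compact (- V)" using V by (simp add: compact_eq_bounded_closed closed_Compl)
    moreover have "U = insert None (Some ` (UNIV - (- V)))"
      using True by (auto simp: V_def image_iff) (metis option.exhaust)
    ultimately show ?thesis
      unfolding openin_Alexandroff_compactification
      by (intro disjI2 exI[of _ "- V"]) (use V in \<open>auto simp: closed_Compl\<close>)
  qed
qed

end

(* Take h(z) = z + sum_m t_m(z) on the unit disc with t_m(z) = -2^(-m) s_m Ln(1 + exp(-2^m) - z cnj(s_m)),
   where the points s_m on the unit circle tend to 1 with 1 - Re s_m = 4^(-m).  Each t_m has derivative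
   with positive real part, so |h(z) - h(w)| >= |z - w|: the map h is
   univalent and its inverse extends continuously to the closure of D = h(disc).  The shift exp(-2^m) is
   chosen so that t_m(s_m) = s_m, whereas t_m is summably small away from s_m, as soon as the distance to
   s_m is at least a multiple of 4^(-m).  Horodiscs at 1 keep such a distance, so h has H-limit h(1) at 1,
   and h is continuous on the closed disc without 1; but h(s_m) tends to h(1) + 1.  Thus D carries spikes of
   length about 1 accumulating at a segment, and its boundary is not locally connected at h(1) + 1.

   By Wolff's lemma the orbits of a fixed point free self-map of the disc stay in a horodisc at some
   boundary point, to which they converge.  H-limits of a Riemann map therefore give the Denjoy-Wolff
   Property of its image. *)
theory Submission
  imports Defs
begin

section \<open>A univalent map with spikes accumulating at 1\<close>

text \<open>The base 4 is dictated by the geometry of horodiscs. A point z of a horodisc at 1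
  satisfies |1 - z|^2 < 2 R (1 - |z|), so its distance to a circle point s near 1 is at least of the
  order |1 - s|^2, and |1 - s_m|^2 = 2 * 4^(-m). At that distance the logarithm in t_m is only O(m),
  which the factor 2^(-m) makes summable, while the shift lets it grow to 2^m at s_m itself. The
  irregularity at 1 is thereby confined to tangential approach. The boundary of the image is never
  described explicitly: it is studied through the extended Lipschitz inverse, which maps it into the
  circle. The claims about all Riemann maps rest on two facts. Two Riemann maps differ by a disc
  automorphism, which carries horodiscs to horodiscs; and a continuous extension would present the
  boundary as a continuous image of the circle, hence as a locally connected set. Uniform
  convergence on compacta cannot simply be transported by h, which lacks continuous boundary values;
  it comes from a common horodisc containing all orbits that start in a given compact set.\<close>

definition circle_point :: "real \<Rightarrow> complex" where
  "circle_point x = Complex (1 - x) (sqrt (1 - (1 - x)\<^sup>2))"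

definition spike_base :: "nat \<Rightarrow> complex" where
  "spike_base m = circle_point ((1/4) ^ m)"

definition spike_arg :: "nat \<Rightarrow> complex \<Rightarrow> complex" where
  "spike_arg m z = 1 + of_real (exp (- (2 ^ m))) - z * cnj (spike_base m)"

definition spike :: "nat \<Rightarrow> complex \<Rightarrow> complex" where
  "spike m z = - of_real ((1/2) ^ m) * spike_base m * Ln (spike_arg m z)"

definition comb_map :: "complex \<Rightarrow> complex" where
  "comb_map z = z + (\<Sum>m. spike m z)"

section \<open>Geometry of the bases and derivative of a single spike\<close>

lemma norm_circle_point:
  assumes "0 \<le> x" "x \<le> 2"
  shows "cmod (circle_point x) = 1"
proof -
  have "(1 - x)\<^sup>2 \<le> 1"
    using assms by (simp add: abs_le_square_iff[of "1 - x" 1, simplified, symmetric] abs_le_iff)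
  then show ?thesis
    by (simp add: circle_point_def cmod_def)
qed

lemma quarter_power_bounds: "0 < (1/4::real) ^ m" "(1/4::real) ^ m \<le> 1"
  by (auto intro: power_le_one)

lemma norm_spike_base [simp]: "cmod (spike_base m) = 1"
  using quarter_power_bounds[of m] unfolding spike_base_def by (intro norm_circle_point) linarith+

lemma norm_one_minus_circle_point:
  assumes "0 \<le> x" "x \<le> 2"
  shows "(cmod (1 - circle_point x))\<^sup>2 = 2 * x"
proof -
  have "(1 - x)\<^sup>2 \<le> 1"
    using assms by (simp add: abs_le_square_iff[of "1 - x" 1, simplified, symmetric] abs_le_iff)
  then show ?thesis
    using assms by (simp add: circle_point_def cmod_def) (simp add: power2_eq_square algebra_simps)
qed

lemma norm_diff_circle_point_ge: "cmod (circle_point x - circle_point y) \<ge> \<bar>x - y\<bar>"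
  using abs_Re_le_cmod[of "circle_point x - circle_point y"]
  by (simp add: circle_point_def abs_minus_commute)

lemma spike_base_mult_cnj: "spike_base m * cnj (spike_base m) = 1"
  by (metis complex_norm_square norm_spike_base of_real_1 one_power2)

lemma Re_spike_arg:
  assumes "cmod z \<le> 1"
  shows "exp (- (2 ^ m)) \<le> Re (spike_arg m z)"
proof -
  have "Re (z * cnj (spike_base m)) \<le> cmod (z * cnj (spike_base m))"
    by (rule complex_Re_le_cmod)
  also have "\<dots> \<le> 1" using assms by (simp add: norm_mult)
  finally show ?thesis by (simp add: spike_arg_def)
qed

lemma norm_spike_arg_ge_exp:
  assumes "cmod z \<le> 1"
  shows "exp (- (2 ^ m)) \<le> cmod (spike_arg m z)"
  using Re_spike_arg[OF assms, of m] complex_Re_le_cmod[of "spike_arg m z"] by linarith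

lemma Re_spike_arg_pos:
  assumes "cmod z \<le> 1"
  shows "Re (spike_arg m z) > 0"
  using Re_spike_arg[OF assms, of m] by (smt (verit) exp_gt_zero)

text \<open>The number 1 - z * cnj s with s = \<open>spike_base m\<close> is z - s up to a
  unimodular factor, and its real part is nonnegative on the closed disc. Adding the positive shift
  can therefore only enlarge its modulus.\<close>

lemma norm_spike_arg_ge_dist:
  assumes "cmod z \<le> 1"
  shows "cmod (z - spike_base m) \<le> cmod (spike_arg m z)"
proof -
  define v where "v = 1 - z * cnj (spike_base m)"
  define d where "d = exp (- (2 ^ m :: real))"
  have d: "d > 0" by (simp add: d_def)
  have "Re v \<ge> 0"
    using Re_spike_arg[OF assms, of m] by (simp add: v_def spike_arg_def)
  then have "cmod v \<le> cmod (v + of_real d)"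
    using d unfolding cmod_def by (intro real_sqrt_le_mono) (auto intro: power_mono)
  also have "v + of_real d = spike_arg m z"
    by (simp add: v_def spike_arg_def d_def)
  finally have "cmod v \<le> cmod (spike_arg m z)" .
  moreover have "z - spike_base m = - spike_base m * v"
    using spike_base_mult_cnj[of m] by (simp add: v_def algebra_simps)
  ultimately show ?thesis by (simp add: norm_mult)
qed

lemma norm_spike_arg_le:
  assumes "cmod z \<le> 1"
  shows "cmod (spike_arg m z) \<le> 3"
proof -
  have "cmod (spike_arg m z) \<le> cmod (1 + of_real (exp (- (2 ^ m)))) + cmod (z * cnj (spike_base m))"
    unfolding spike_arg_def by (rule norm_triangle_ineq4)
  also have "\<dots> \<le> (1 + exp (- (2 ^ m))) + 1"
    using assms by (intro add_mono order_trans[OF norm_triangle_ineq]) (auto simp: norm_mult)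
  also have "\<dots> \<le> 3" by simp
  finally show ?thesis .
qed

lemma spike_arg_nonpos_Reals:
  assumes "cmod z \<le> 1"
  shows "spike_arg m z \<notin> \<real>\<^sub>\<le>\<^sub>0"
  using Re_spike_arg_pos[OF assms, of m] by (auto simp: complex_nonpos_Reals_iff)

text \<open>The factor \<open>spike_base m\<close> in \<open>spike\<close> cancels the factor
  \<open>cnj (spike_base m)\<close> from the chain rule, so the derivative is a positive multiple of
  1 / \<open>spike_arg m z\<close> and has positive real part. The shift moves the branch point out
  of the closed disc, so boundary points are included.\<close>

lemma has_field_derivative_spike:
  assumes "cmod z \<le> 1"
  shows "(spike m has_field_derivative of_real ((1/2) ^ m) / spike_arg m z) (at z within S)"
proof -
  have 1: "(spike_arg m has_field_derivative - cnj (spike_base m)) (at z within S)"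
    unfolding spike_arg_def by (auto intro!: derivative_eq_intros)
  have "(spike m has_field_derivative
      - of_real ((1/2) ^ m) * spike_base m * (inverse (spike_arg m z) * - cnj (spike_base m))) (at z within S)"
    unfolding spike_def
    by (intro DERIV_cmult DERIV_chain2[OF has_field_derivative_Ln 1] spike_arg_nonpos_Reals assms)
  moreover have "- a * b * (c * - d) = a * c * (b * d)" for a b c d :: complex
    by (simp add: mult_ac)
  ultimately show ?thesis by (simp only: spike_base_mult_cnj divide_inverse mult_1_right)
qed

lemma holomorphic_spike: "spike m holomorphic_on ball 0 1"
  unfolding holomorphic_on_def field_differentiable_def
  by (metis has_field_derivative_spike less_imp_le mem_ball_0)

lemma continuous_on_spike: "continuous_on (cball 0 1) (spike m)"
  using has_field_derivative_spike[of _ m "cball 0 1"]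
  by (auto intro!: DERIV_continuous_on)

text \<open>The Noshiro-Warschawski argument: the derivative has positive real part along the
  segment from w to z. In this form of monotonicity the contributions of infinitely many spikes can
  be added, which injectivity of each spike would not allow.\<close>

lemma Re_spike_diff_nonneg:
  assumes "cmod z \<le> 1" "cmod w \<le> 1"
  shows "0 \<le> Re (cnj (z - w) * (spike m z - spike m w))"
proof -
  define l where "l s = w + of_real s * (z - w)" for s :: real
  have l: "cmod (l s) \<le> 1" if "0 \<le> s" "s \<le> 1" for s
  proof -
    have "l s \<in> closed_segment w z"
      unfolding closed_segment_def using that by (auto simp: l_def scaleR_conv_of_real algebra_simps)
    then have "l s \<in> cball 0 1"
      using closed_segment_subset[of w "cball 0 1" z] assms by auto
    then show ?thesis by simp
  qed
  define \<phi> where "\<phi> s = Re (cnj (z - w) * spike m (l s))" for s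
  have d: "(\<phi> has_real_derivative Re (cnj (z - w) * (of_real ((1/2) ^ m) / spike_arg m (l s) * (z - w)))) (at s)"
    if "0 \<le> s" "s \<le> 1" for s
  proof -
    have "(l has_vector_derivative (z - w)) (at s)"
      unfolding l_def by (auto intro!: derivative_eq_intros)
    then have "((\<lambda>s. spike m (l s)) has_vector_derivative
        (z - w) * (of_real ((1/2) ^ m) / spike_arg m (l s))) (at s)"
      using field_vector_diff_chain_at[of l _ s "spike m", OF _ has_field_derivative_spike[OF l[OF that]]]
      by (simp add: o_def)
    from bounded_linear.has_vector_derivative[OF bounded_linear_compose[OF bounded_linear_Re bounded_linear_mult_right] this, of "cnj (z - w)"]
    show ?thesis
      unfolding \<phi>_def has_real_derivative_iff_has_vector_derivative by (simp add: mult_ac)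
  qed
  have "\<phi> 0 \<le> \<phi> 1"
  proof (rule DERIV_nonneg_imp_nondecreasing[of 0 1 \<phi>])
    fix s :: real assume s: "0 \<le> s" "s \<le> 1"
    have "cnj (z - w) * (of_real ((1/2) ^ m) / spike_arg m (l s) * (z - w))
       = of_real ((1/2) ^ m * (cmod (z - w))\<^sup>2) * inverse (spike_arg m (l s))"
    proof -
      have "of_real ((cmod (z - w))\<^sup>2) = (z - w) * cnj (z - w)"
        by (rule complex_norm_square)
      then show ?thesis by (simp only: of_real_mult divide_inverse mult_ac)
    qed
    moreover have "0 \<le> Re (of_real ((1/2) ^ m * (cmod (z - w))\<^sup>2) * inverse (spike_arg m (l s)))"
      using Re_spike_arg_pos[OF l[OF s], of m]
      by (simp add: Re_complex_div_gt_0)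
    ultimately show "\<exists>y. (\<phi> has_real_derivative y) (at s) \<and> 0 \<le> y"
      using d[OF s] by (intro exI conjI) auto
  qed auto
  then show ?thesis by (simp add: \<phi>_def l_def right_diff_distrib)
qed

text \<open>The modulus of the argument is at most 3, so the logarithm of the modulus lies between
  ln d and 2; the argument lies in the right half-plane, so its angle is at most 2 in absolute
  value. The constant 4 is the sum of these two bounds.\<close>

lemma norm_spike_le_ln:
  assumes z: "cmod z \<le> 1" and d: "0 < d" "d \<le> 1" "d \<le> cmod (spike_arg m z)"
  shows "cmod (spike m z) \<le> (1/2) ^ m * (4 - ln d)"
proof -
  define u where "u = spike_arg m z"
  have u: "u \<noteq> 0" "Re u > 0"
    using Re_spike_arg_pos[OF z, of m] by (auto simp: u_def)
  have "ln (cmod u) \<le> cmod u - 1"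
    using u by (intro ln_le_minus_one) auto
  also have "\<dots> \<le> 2"
    using norm_spike_arg_le[OF z, of m] by (simp add: u_def)
  finally have 1: "ln (cmod u) \<le> 2" .
  have 2: "ln d \<le> ln (cmod u)"
    using d u by (simp add: u_def)
  have 3: "ln d \<le> 0"
    using d by simp
  have 4: "\<bar>Im (Ln u)\<bar> \<le> 2"
    using Re_Ln_pos_lt[of u] u pi_less_4 by auto
  have "cmod (Ln u) \<le> \<bar>Re (Ln u)\<bar> + \<bar>Im (Ln u)\<bar>"
    by (rule cmod_le)
  also have "\<dots> \<le> 4 - ln d"
    using u 1 2 3 4 by simp
  finally have "cmod (Ln u) \<le> 4 - ln d" .
  then show ?thesis
    by (simp add: spike_def norm_mult norm_power u_def mult_left_mono)
qed

text \<open>Without a distance assumption only the shift limits the logarithm, and its 2^m exactly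
  cancels the factor (1/2)^m. The resulting bound is uniform in m but not summable, so it can be
  afforded for one spike at a time.\<close>

lemma norm_spike_le_5:
  assumes "cmod z \<le> 1"
  shows "cmod (spike m z) \<le> 5"
proof -
  have "cmod (spike m z) \<le> (1/2) ^ m * (4 - ln (exp (- (2 ^ m))))"
    using assms by (intro norm_spike_le_ln norm_spike_arg_ge_exp) auto
  also have "\<dots> = 4 * (1/2) ^ m + 1"
    by (simp add: algebra_simps power_one_over)
  also have "\<dots> \<le> 5"
    by (simp add: power_le_one)
  finally show ?thesis .
qed

text \<open>At distance of order 4^-m the logarithm costs only m * ln 4, and ln 4 <= 2 gives the
  linear term.\<close>

lemma norm_spike_le:
  assumes z: "cmod z \<le> 1" and \<kappa>: "0 < \<kappa>" "\<kappa> \<le> 1"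
    and far: "\<kappa> * (1/4) ^ m \<le> cmod (z - spike_base m)"
  shows "cmod (spike m z) \<le> (1/2) ^ m * (4 + 2 * real m - ln \<kappa>)"
proof -
  have "cmod (spike m z) \<le> (1/2) ^ m * (4 - ln (\<kappa> * (1/4) ^ m))"
    using \<kappa> far norm_spike_arg_ge_dist[OF z, of m]
    by (intro norm_spike_le_ln[OF z]) (auto simp: mult_le_one power_le_one)
  also have "ln (\<kappa> * (1/4) ^ m) = ln \<kappa> - real m * ln 4"
    using \<kappa> by (simp add: ln_mult ln_realpow ln_div)
  also have "(1/2) ^ m * (4 - (ln \<kappa> - real m * ln 4)) \<le> (1/2) ^ m * (4 + 2 * real m - ln \<kappa>)"
  proof -
    have "ln (4::real) = 2 * ln 2"
      using ln_realpow[of 2 2] by simp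
    then have "ln (4::real) \<le> 2"
      using ln_2_less_1 by simp
    then have "real m * ln 4 \<le> real m * 2"
      by (intro mult_left_mono) auto
    then show ?thesis
      by (intro mult_left_mono) auto
  qed
  finally show ?thesis .
qed

section \<open>Summation of the spikes and continuity away from 1\<close>

lemma summable_spike_bound: "summable (\<lambda>m. (1/2) ^ m * (4 + 2 * real m - c))"
proof -
  have "summable (\<lambda>m. (1/2) ^ m :: real)"
    by (simp add: summable_geometric_iff)
  moreover have "summable (\<lambda>m. real m * (1/2) ^ m)"
  proof (rule summable_comparison_test')
    show "summable (\<lambda>m. 2 * (3/4) ^ m :: real)"
      by (intro summable_mult) (simp add: summable_geometric_iff)
    fix m :: nat
    \<comment> \<open>The linear factor is absorbed into a geometric one; the ratio 3/2 leaves 3/2 *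
      1/2 = 3/4 < 1.\<close>
    have "real m \<le> 2 * (3/2) ^ m"
      using Bernoulli_inequality[of "1/2 :: real" m] by simp
    then have "real m * (1/2) ^ m \<le> 2 * (3/2) ^ m * (1/2) ^ m"
      by (intro mult_right_mono) auto
    also have "\<dots> = 2 * (3/4) ^ m"
      by (simp flip: power_mult_distrib)
    finally show "norm (real m * (1/2) ^ m) \<le> 2 * (3/4) ^ m" by simp
  qed
  ultimately have "summable (\<lambda>m. (4 - c) * (1/2) ^ m + 2 * (real m * (1/2) ^ m))"
    by (intro summable_add summable_mult)
  then show ?thesis
    by (simp add: algebra_simps)
qed

text \<open>The relation \<open>A\<close> allows the one spike on which a point of the family sits to be left out of the sum.\<close>

lemma tendsto_suminf_spike:
  assumes x: "(x \<longlongrightarrow> l) F" "F \<noteq> bot" "\<And>k. cmod (x k) \<le> 1"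
    and \<kappa>: "0 < \<kappa>" "\<kappa> \<le> 1"
    and far: "eventually (\<lambda>k. \<forall>m\<ge>N. A k m \<longrightarrow> \<kappa> * (1/4) ^ m \<le> cmod (x k - spike_base m)) F"
    and A: "\<And>m. eventually (\<lambda>k. A k m) F"
  shows "((\<lambda>k. \<Sum>m. if A k m then spike m (x k) else 0) \<longlongrightarrow> (\<Sum>m. spike m l)) F"
    and "summable (\<lambda>m. norm (spike m l))"
proof -
  have l: "cmod l \<le> 1"
    using x by (intro tendsto_upperbound[OF tendsto_norm[OF x(1)]]) auto
  have "((\<lambda>k. if A k m then spike m (x k) else 0) \<longlongrightarrow> spike m l) F" for m
  proof -
    have "((\<lambda>k. spike m (x k)) \<longlongrightarrow> spike m l) F"
      using x(3) l by (intro continuous_on_tendsto_compose[OF continuous_on_spike x(1)]) auto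
    then show ?thesis
      by (rule Lim_transform_eventually) (use A[of m] in \<open>auto elim: eventually_mono\<close>)
  qed
  \<comment> \<open>Tannery's theorem asks for a majorant only eventually in both indices jointly,
    which is why \<open>far\<close> speaks of m \<ge> N alone.\<close>
  moreover have "eventually (\<lambda>(m, k). norm (if A k m then spike m (x k) else 0)
      \<le> (1/2) ^ m * (4 + 2 * real m - ln \<kappa>)) (at_top \<times>\<^sub>F F)"
  proof -
    have c: "0 \<le> (1/2) ^ m * (4 + 2 * real m - ln \<kappa>)" for m
    proof -
      have "ln \<kappa> \<le> 0" using \<kappa> by simp
      then show ?thesis by (intro mult_nonneg_nonneg) auto
    qed
    have "eventually (\<lambda>m. m \<ge> N) at_top"
      by (rule eventually_ge_at_top)
    then show ?thesis
      using far
    proof (rule eventually_prodI[THEN eventually_mono], goal_cases)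
      case (1 p)
      then show ?case
        using norm_spike_le[OF x(3) \<kappa>] c by (auto simp: case_prod_beta)
    qed
  qed
  ultimately show "((\<lambda>k. \<Sum>m. if A k m then spike m (x k) else 0) \<longlongrightarrow> (\<Sum>m. spike m l)) F"
    and "summable (\<lambda>m. norm (spike m l))"
    using tannerys_theorem[where a = "\<lambda>m k. if A k m then spike m (x k) else 0" and b = "\<lambda>m. spike m l",
        OF _ _ summable_spike_bound x(2)] by blast+
qed

lemma tendsto_comb_map:
  assumes x: "(x \<longlongrightarrow> l) F" "F \<noteq> bot" "\<And>k. cmod (x k) \<le> 1"
    and \<kappa>: "0 < \<kappa>" "\<kappa> \<le> 1"
    and far: "eventually (\<lambda>k. \<forall>m\<ge>N. \<kappa> * (1/4) ^ m \<le> cmod (x k - spike_base m)) F"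
  shows "((\<lambda>k. comb_map (x k)) \<longlongrightarrow> comb_map l) F"
  using tendsto_suminf_spike(1)[OF x \<kappa>, of N "\<lambda>_ _. True"] far x(1)
  unfolding comb_map_def by (auto intro!: tendsto_add)

lemma spike_base_far_from_1: "(1/4) ^ m \<le> cmod (1 - spike_base m)"
  using norm_diff_circle_point_ge[of 0 "(1/4) ^ m"]
  by (simp add: spike_base_def circle_point_def one_complex.code)

lemma circle_point_tendsto_1:
  assumes "(x \<longlongrightarrow> 0) F"
  shows "((\<lambda>k. circle_point (x k)) \<longlongrightarrow> 1) F"
proof -
  have "((\<lambda>k. Complex (1 - x k) (sqrt (1 - (1 - x k)\<^sup>2)))
      \<longlongrightarrow> Complex (1 - 0) (sqrt (1 - (1 - 0)\<^sup>2))) F"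
    by (intro tendsto_intros assms)
  then show ?thesis
    by (simp add: circle_point_def one_complex.code)
qed

lemma spike_base_tendsto_1: "spike_base \<longlonglongrightarrow> 1"
proof -
  have "(\<lambda>m. (1/4::real) ^ m) \<longlonglongrightarrow> 0"
    by (intro LIMSEQ_power_zero) auto
  from circle_point_tendsto_1[OF this] show ?thesis
    by (simp add: spike_base_def[abs_def])
qed

text \<open>The bases accumulate only at 1, so all but finitely many keep a fixed distance d from a
  neighbourhood of l, far more than the scale 4^-m asks for. The finitely many others are harmless
  because every single spike is continuous on the closed disc; l may itself be a base.\<close>

lemma tendsto_comb_map_off_1:
  assumes x: "(x \<longlongrightarrow> l) F" "F \<noteq> bot" "\<And>k. cmod (x k) \<le> 1" and "l \<noteq> 1"
  shows "((\<lambda>k. comb_map (x k)) \<longlongrightarrow> comb_map l) F"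
proof -
  define d where "d = cmod (l - 1) / 3"
  have d: "d > 0" using \<open>l \<noteq> 1\<close> by (simp add: d_def)
  obtain N where N: "\<And>m. m \<ge> N \<Longrightarrow> cmod (spike_base m - 1) < d"
    using LIMSEQ_D[OF spike_base_tendsto_1 d] by blast
  have "eventually (\<lambda>k. cmod (x k - l) < d) F"
    using tendstoD[OF x(1) d] by (simp add: dist_norm)
  then have "eventually (\<lambda>k. \<forall>m\<ge>N. min 1 d * (1/4) ^ m \<le> cmod (x k - spike_base m)) F"
  proof eventually_elim
    case (elim k)
    show ?case
    proof (intro allI impI)
      fix m assume "m \<ge> N"
      have "3 * d = cmod ((l - x k) + (x k - spike_base m) + (spike_base m - 1))"
        by (simp add: d_def)
      also have "\<dots> \<le> cmod (l - x k) + cmod (x k - spike_base m) + cmod (spike_base m - 1)"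
        by (intro order_trans[OF norm_triangle_ineq] add_mono norm_triangle_ineq order_refl)
      finally have "d \<le> cmod (x k - spike_base m)"
        using elim N[OF \<open>m \<ge> N\<close>] by (simp add: norm_minus_commute)
      moreover have "min 1 d * (1/4) ^ m \<le> d * 1"
        using d by (intro mult_mono) (auto intro: power_le_one)
      ultimately show "min 1 d * (1/4) ^ m \<le> cmod (x k - spike_base m)" by simp
    qed
  qed
  then show ?thesis
    using d by (intro tendsto_comb_map[OF x, of "min 1 d" N]) auto
qed

text \<open>Constant families turn the limit theorem into a summability statement. At z = 1 the
  separation constant is 1; elsewhere the bases eventually stay away from z.\<close>

lemma summable_spike:
  assumes "cmod z \<le> 1"
  shows "summable (\<lambda>m. norm (spike m z))"
proof (cases "z = 1")
  case True
  have *: "1 * (1/4) ^ m \<le> cmod (1 - spike_base m)" for m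
    using spike_base_far_from_1[of m] by simp
  show ?thesis
    unfolding True
    by (rule tendsto_suminf_spike(2)[of "\<lambda>_. 1" 1 sequentially 1 0 "\<lambda>_ _. True"]) (use * in auto)
next
  case False
  define d where "d = cmod (z - 1) / 2"
  have d: "d > 0" using False by (simp add: d_def)
  obtain N where N: "\<And>m. m \<ge> N \<Longrightarrow> cmod (spike_base m - 1) < d"
    using LIMSEQ_D[OF spike_base_tendsto_1 d] by blast
  have "min 1 d * (1/4) ^ m \<le> cmod (z - spike_base m)" if "m \<ge> N" for m
  proof -
    have "2 * d \<le> cmod (z - spike_base m) + cmod (spike_base m - 1)"
      using norm_triangle_ineq[of "z - spike_base m" "spike_base m - 1"] by (simp add: d_def)
    moreover have "min 1 d * (1/4) ^ m \<le> d * 1"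
      using d by (intro mult_mono) (auto intro: power_le_one)
    ultimately show ?thesis using N[OF that] by simp
  qed
  then show ?thesis
    using d assms
    by (intro tendsto_suminf_spike(2)[of "\<lambda>_. z" z sequentially "min 1 d" N "\<lambda>_ _. True"]) auto
qed

section \<open>Univalence and holomorphy of \<open>comb_map\<close>\<close>

lemma comb_map_expanding:
  assumes "cmod z \<le> 1" "cmod w \<le> 1"
  shows "cmod (z - w) \<le> cmod (comb_map z - comb_map w)"
proof (cases "z = w")
  case False
  note s = summable_norm_cancel[OF summable_spike[OF assms(1)]]
    summable_norm_cancel[OF summable_spike[OF assms(2)]]
  have s': "summable (\<lambda>m. cnj (z - w) * (spike m z - spike m w))"
    using s by (intro summable_mult summable_diff)
  have "cnj (z - w) * (comb_map z - comb_map w)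
      = cnj (z - w) * (z - w) + cnj (z - w) * ((\<Sum>m. spike m z) - (\<Sum>m. spike m w))"
    by (simp add: comb_map_def algebra_simps)
  also have "cnj (z - w) * ((\<Sum>m. spike m z) - (\<Sum>m. spike m w))
      = (\<Sum>m. cnj (z - w) * (spike m z - spike m w))"
    using s by (simp add: suminf_diff suminf_mult summable_diff)
  also have "cnj (z - w) * (z - w) = of_real ((cmod (z - w))\<^sup>2)"
    by (simp only: complex_norm_square mult.commute)
  finally have "Re (cnj (z - w) * (comb_map z - comb_map w))
      = (cmod (z - w))\<^sup>2 + (\<Sum>m. Re (cnj (z - w) * (spike m z - spike m w)))"
    using Re_suminf[OF s'] by simp
  \<comment> \<open>The summand z of \<open>comb_map\<close> already yields the full square of |z -
    w|; the spikes only add nonnegative terms.\<close>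
  moreover have "0 \<le> (\<Sum>m. Re (cnj (z - w) * (spike m z - spike m w)))"
    using Re_spike_diff_nonneg[OF assms] summable_Re[OF s'] by (intro suminf_nonneg) auto
  ultimately have "(cmod (z - w))\<^sup>2 \<le> Re (cnj (z - w) * (comb_map z - comb_map w))"
    by simp
  also have "\<dots> \<le> cmod (z - w) * cmod (comb_map z - comb_map w)"
    using complex_Re_le_cmod[of "cnj (z - w) * (comb_map z - comb_map w)"]
    by (simp add: norm_mult del: complex_cnj_diff)
  finally show ?thesis
    using False by (simp add: power2_eq_square)
qed auto

lemma inj_on_comb_map: "inj_on comb_map (cball 0 1)"
  using comb_map_expanding by (force intro!: inj_onI)

lemma holomorphic_comb_map: "comb_map holomorphic_on ball 0 1"
proof -
  have "(\<lambda>z. \<Sum>m. spike m z) holomorphic_on ball 0 1"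
  proof (rule holomorphic_uniform_sequence[where f = "\<lambda>n z. \<Sum>m<n. spike m z"])
    fix z :: complex assume z: "z \<in> ball 0 1"
    \<comment> \<open>Half the gap to the circle: all of \<open>cball z d\<close> stays at distance
      at least d from the circle, hence from all bases at once, and the majorant becomes
      geometric.\<close>
    define d where "d = (1 - cmod z) / 2"
    have d: "d > 0" "d \<le> 1" using z norm_ge_zero[of z] by (auto simp: d_def simp del: norm_ge_zero)
    have *: "cmod w \<le> 1 - d" if "w \<in> cball z d" for w
      using that norm_triangle_ineq2[of w z] by (simp add: dist_norm norm_minus_commute d_def field_simps)
    have "cmod (spike m w) \<le> (1/2) ^ m * (4 - ln d)" if "w \<in> cball z d" for m w
    proof (rule norm_spike_le_ln)
      show "cmod w \<le> 1" using *[OF that] d by simp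
      then have "cmod (w - spike_base m) \<le> cmod (spike_arg m w)"
        by (rule norm_spike_arg_ge_dist)
      then show "d \<le> cmod (spike_arg m w)"
        using *[OF that] norm_triangle_ineq2[of "spike_base m" w] by (simp add: norm_minus_commute)
    qed (use d in auto)
    then have "uniform_limit (cball z d) (\<lambda>n z. \<Sum>m<n. spike m z) (\<lambda>z. \<Sum>m. spike m z) sequentially"
      by (intro Weierstrass_m_test[where M = "\<lambda>m. (1/2) ^ m * (4 - ln d)"] summable_mult2)
        (auto simp: summable_geometric_iff)
    moreover have "cball z d \<subseteq> ball 0 1"
      using * d by force
    ultimately show "\<exists>d>0. cball z d \<subseteq> ball 0 1 \<and>
        uniform_limit (cball z d) (\<lambda>n z. \<Sum>m<n. spike m z) (\<lambda>z. \<Sum>m. spike m z) sequentially"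
      using d by blast
  qed (auto intro!: holomorphic_intros holomorphic_spike)
  then show ?thesis
    unfolding comb_map_def[abs_def] by (intro holomorphic_intros)
qed

section \<open>The image domain\<close>

lemma dist_spike_base_ge: "\<bar>Re z - (1 - (1/4) ^ m)\<bar> \<le> cmod (z - spike_base m)"
  using abs_Re_le_cmod[of "z - spike_base m"] by (simp add: spike_base_def circle_point_def)

lemma Re_spike_base: "Re (spike_base m) = 1 - (1/4) ^ m"
  by (simp add: spike_base_def circle_point_def)

lemma quarter_power_less: "(1/4::real) ^ n \<le> (1/4) ^ m / 4" if "m < n"
proof -
  have "(1/4::real) ^ n \<le> (1/4) ^ Suc m"
    using that by (intro power_decreasing) auto
  then show ?thesis by simp
qed

lemma dist_spike_base_spike_base:
  assumes "k \<noteq> m"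
  shows "3/4 * (1/4) ^ m \<le> cmod (spike_base k - spike_base m)"
proof -
  have "3/4 * (1/4) ^ m \<le> \<bar>(1/4::real) ^ m - (1/4) ^ k\<bar>"
  proof (cases "m < k")
    case True
    then show ?thesis
      using quarter_power_less[OF True] by simp
  next
    case False
    then have "k < m" using assms by simp
    then show ?thesis
      using quarter_power_less[OF \<open>k < m\<close>] quarter_power_bounds(1)[of m] by linarith
  qed
  also have "\<dots> \<le> cmod (spike_base k - spike_base m)"
    using dist_spike_base_ge[of "spike_base k" m] by (simp add: Re_spike_base)
  finally show ?thesis .
qed

text \<open>The discs of radius 4^-m / 4 about the bases are pairwise disjoint: for m < n the radii
  add up to at most 5/16 * 4^-m, whereas the centres are 3/4 * 4^-m apart.\<close>

lemma near_at_most_one_spike_base: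
  obtains n where "\<And>m. m \<noteq> n \<Longrightarrow> 1/4 * (1/4) ^ m \<le> cmod (z - spike_base m)"
proof -
  have *: False if "cmod (z - spike_base m) < 1/4 * (1/4) ^ m"
    "cmod (z - spike_base n) < 1/4 * (1/4) ^ n" "m < n" for m n
  proof -
    have "cmod (spike_base n - spike_base m) \<le> cmod (z - spike_base m) + cmod (z - spike_base n)"
      using norm_triangle_ineq4[of "z - spike_base m" "z - spike_base n"] by simp
    then show False
      using dist_spike_base_spike_base[of n m] that quarter_power_less[OF \<open>m < n\<close>]
        quarter_power_bounds(1)[of m] by linarith
  qed
  show ?thesis
  proof (cases "\<exists>n. cmod (z - spike_base n) < 1/4 * (1/4) ^ n")
    case True
    then obtain n where "cmod (z - spike_base n) < 1/4 * (1/4) ^ n" by blast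
    then show ?thesis
      using * by (intro that[of n]) (metis linorder_neqE_nat not_le)
  next
    case False
    \<comment> \<open>No base is near z, so any index may be named; 0 is a placeholder.\<close>
    then show ?thesis
      by (intro that[of 0]) (auto simp: not_less)
  qed
qed

text \<open>At each z all spikes but one obey the summable bound with separation constant 1/4, and
  the exceptional one is at most 5.\<close>

lemma bounded_comb_map: "bounded (comb_map ` cball 0 1)"
proof -
  define b where "b m = (1/2) ^ m * (4 + 2 * real m - ln (1/4))" for m
  have b: "summable b"
    unfolding b_def by (rule summable_spike_bound)
  have "cmod (comb_map z) \<le> 1 + (suminf b + 5)" if "z \<in> cball 0 1" for z
  proof -
    have z: "cmod z \<le> 1" using that by simp
    obtain n where n: "\<And>m. m \<noteq> n \<Longrightarrow> 1/4 * (1/4) ^ m \<le> cmod (z - spike_base m)"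
      using near_at_most_one_spike_base[of z] by blast
    have s: "(\<lambda>m. b m + (if m = n then 5 else 0)) sums (suminf b + 5)"
      using sums_add[OF summable_sums[OF b] sums_single[of n "\<lambda>_. 5"]] .
    have "b m \<ge> 0" for m
      unfolding b_def by (intro mult_nonneg_nonneg) (auto simp: ln_div)
    moreover have "cmod (spike m z) \<le> b m" if "m \<noteq> n" for m
      unfolding b_def using n[OF that] z by (intro norm_spike_le) auto
    ultimately have "cmod (spike m z) \<le> b m + (if m = n then 5 else 0)" for m
      using norm_spike_le_5[OF z, of m] by (cases "m = n") (auto simp: add_increasing)
    then have "(\<Sum>m. cmod (spike m z)) \<le> (\<Sum>m. b m + (if m = n then 5 else 0))"
      using s by (intro suminf_le summable_spike z) (auto simp: sums_iff)
    also have "\<dots> = suminf b + 5"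
      using s by (simp add: sums_iff)
    finally have "cmod (\<Sum>m. spike m z) \<le> suminf b + 5"
      using summable_norm[OF summable_spike[OF z]] by simp
    then show ?thesis
      unfolding comb_map_def using z norm_triangle_ineq[of z "\<Sum>m. spike m z"] by linarith
  qed
  then show ?thesis
    unfolding bounded_iff by blast
qed

section \<open>Behaviour at 1: tips, gaps between the spikes, horodiscs\<close>

lemma spike_at_spike_base: "spike m (spike_base m) = spike_base m"
proof -
  have "spike_arg m (spike_base m) = of_real (exp (- (2 ^ m)))"
    by (simp add: spike_arg_def spike_base_mult_cnj)
  then have "spike m (spike_base m) = - of_real ((1/2) ^ m) * spike_base m * of_real (- (2 ^ m))"
    unfolding spike_def by (simp add: Ln_of_real del: of_real_exp)
  also have "\<dots> = spike_base m"
    by (simp add: power_one_over)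
  finally show ?thesis .
qed

text \<open>At \<open>spike_base n\<close> the n-th term is split off. The others converge to the
  full sum at 1, since the bases are separated with constant 3/4 and each fixed m differs from n
  eventually. The term split off equals \<open>spike_base n\<close> and supplies the extra
  1.\<close>

lemma comb_map_spike_base_tendsto: "(\<lambda>n. comb_map (spike_base n)) \<longlonglongrightarrow> comb_map 1 + 1"
proof -
  define r where "r n = (\<Sum>m. if m \<noteq> n then spike m (spike_base n) else 0)" for n
  have r: "r \<longlonglongrightarrow> (\<Sum>m. spike m 1)"
    unfolding r_def using dist_spike_base_spike_base
    by (intro tendsto_suminf_spike(1)[of spike_base 1 sequentially "3/4" 0 "\<lambda>n m. m \<noteq> n"]
        spike_base_tendsto_1) (auto intro: eventually_mono[OF eventually_gt_at_top])
  have "(\<Sum>m. spike m (spike_base n)) = r n + spike_base n" for n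
  proof -
    have s: "summable (\<lambda>m. spike m (spike_base n))"
      by (intro summable_norm_cancel[OF summable_spike]) simp
    have "(\<lambda>m. if m = n then spike m (spike_base n) else 0) sums spike n (spike_base n)"
      by (rule sums_single)
    from sums_diff[OF summable_sums[OF s] this]
    have "(\<lambda>m. spike m (spike_base n) - (if m = n then spike m (spike_base n) else 0))
       sums ((\<Sum>m. spike m (spike_base n)) - spike_base n)"
      by (simp add: spike_at_spike_base)
    moreover have "(\<lambda>m. spike m (spike_base n) - (if m = n then spike m (spike_base n) else 0))
       = (\<lambda>m. if m \<noteq> n then spike m (spike_base n) else 0)"
      by auto
    ultimately show ?thesis
      unfolding r_def by (simp add: sums_iff)
  qed
  then have "comb_map (spike_base n) = spike_base n + (r n + spike_base n)" for n
    by (simp add: comb_map_def)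
  moreover have "(\<lambda>n. spike_base n + (r n + spike_base n)) \<longlonglongrightarrow> 1 + ((\<Sum>m. spike m 1) + 1)"
    by (intro tendsto_intros spike_base_tendsto_1 r)
  ultimately show ?thesis
    by (simp add: comb_map_def add.assoc)
qed

text \<open>The prescribed real part lies between those of two consecutive bases, so horizontal
  distance alone separates x n from every base; the case m = n attains the constant 1/2. Since only
  real parts enter, the lemma serves points of the circle and their conjugates alike.\<close>

lemma comb_map_between_tendsto:
  assumes "\<And>n. cmod (x n) \<le> 1" "\<And>n. Re (x n) = 1 - (1/4) ^ n / 2" "x \<longlonglongrightarrow> 1"
  shows "(\<lambda>n. comb_map (x n)) \<longlonglongrightarrow> comb_map 1"
proof (rule tendsto_comb_map[OF assms(3) _ assms(1), of "1/2" 0])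
  show "\<forall>\<^sub>F n in sequentially. \<forall>m\<ge>0. 1/2 * (1/4) ^ m \<le> cmod (x n - spike_base m)"
  proof (intro always_eventually allI impI)
    fix n m :: nat
    have "1/2 * (1/4) ^ m \<le> \<bar>(1/4::real) ^ m - (1/4) ^ n / 2\<bar>"
    proof (cases m n rule: linorder_cases)
      case less
      then show ?thesis
        using quarter_power_less[OF less] quarter_power_bounds(1)[of m] by linarith
    next
      case greater
      then show ?thesis
        using quarter_power_less[OF greater] quarter_power_bounds(1)[of n] by linarith
    qed auto
    also have "\<dots> \<le> cmod (x n - spike_base m)"
      using dist_spike_base_ge[of "x n" m] by (simp add: assms(2))
    finally show "1/2 * (1/4) ^ m \<le> cmod (x n - spike_base m)" .
  qed
qed auto

lemma horodisc_far_from_spike_base: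
  assumes "R > 0" and z: "z \<in> horodisc 1 R"
  shows "min (1/2) (1 / (4 * R)) * (1/4) ^ m \<le> cmod (z - spike_base m)"
proof -
  define x where "x = (1/4::real) ^ m"
  define d where "d = cmod (z - spike_base m)"
  have x: "0 < x" "x \<le> 1"
    unfolding x_def by (rule quarter_power_bounds)+
  have z1: "cmod z < 1" "(cmod (1 - z))\<^sup>2 / (1 - (cmod z)\<^sup>2) < R"
    using z by (auto simp: horodisc_def)
  have "(cmod z)\<^sup>2 < 1"
    using z1 by (simp add: power_less_one_iff)
  then have z2: "(cmod (1 - z))\<^sup>2 < R * (1 - (cmod z)\<^sup>2)"
    using z1 by (simp add: field_simps)
  have "1 - cmod z \<le> d"
    unfolding d_def using norm_triangle_ineq2[of "spike_base m" z] by (simp add: norm_minus_commute)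
  have "1 - (cmod z)\<^sup>2 = (1 - cmod z) * (1 + cmod z)"
    by (simp add: power2_eq_square algebra_simps)
  also have "\<dots> \<le> (1 - cmod z) * 2"
    using z1 by (intro mult_left_mono) auto
  finally have "1 - (cmod z)\<^sup>2 \<le> 2 * d"
    using \<open>1 - cmod z \<le> d\<close> by simp
  then have "R * (1 - (cmod z)\<^sup>2) \<le> R * (2 * d)"
    using \<open>R > 0\<close> by (intro mult_left_mono) auto
  with z2 have z3: "(cmod (1 - z))\<^sup>2 < 2 * R * d" by simp
  have sb: "(cmod (1 - spike_base m))\<^sup>2 = 2 * x"
    unfolding spike_base_def x_def
    using quarter_power_bounds[of m] by (intro norm_one_minus_circle_point) linarith+
  have "min (1/2) (1 / (4 * R)) * x \<le> d"
  \<comment> \<open>If z is this close to the base, then |1 - z| is at least half of |1 -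
    \<open>spike_base m\<close>|, because the latter is at least x. The horodisc inequality
    \<open>z3\<close> then bounds d from below by x / (4 R).\<close>
  proof (cases "d \<le> x / 2")
    case True
    have "cmod (1 - spike_base m) \<le> cmod (1 - z) + d"
      unfolding d_def using norm_triangle_ineq[of "1 - z" "z - spike_base m"] by simp
    moreover have "x \<le> cmod (1 - spike_base m)"
      unfolding x_def by (rule spike_base_far_from_1)
    ultimately have "cmod (1 - spike_base m) / 2 \<le> cmod (1 - z)"
      using True by linarith
    then have "(cmod (1 - spike_base m) / 2)\<^sup>2 \<le> (cmod (1 - z))\<^sup>2"
      by (intro power_mono) auto
    then have "x / 2 < 2 * R * d"
      using z3 sb by (simp add: power_divide)
    then have "1 / (4 * R) * x \<le> d"
      using \<open>R > 0\<close> by (simp add: field_simps)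
    moreover have "min (1/2) (1 / (4 * R)) * x \<le> 1 / (4 * R) * x"
      using x by (intro mult_right_mono) auto
    ultimately show ?thesis by linarith
  next
    case False
    moreover have "min (1/2) (1 / (4 * R)) * x \<le> 1/2 * x"
      using x by (intro mult_right_mono) auto
    ultimately show ?thesis by linarith
  qed
  then show ?thesis by (simp add: x_def d_def)
qed

lemma comb_map_horodisc_tendsto:
  assumes z: "\<And>n. z n \<in> ball 0 1" "z \<longlonglongrightarrow> \<sigma>"
    and R: "R > 0" "\<forall>\<^sub>F n in sequentially. z n \<in> horodisc \<sigma> R"
  shows "(\<lambda>n. comb_map (z n)) \<longlonglongrightarrow> comb_map \<sigma>"
proof (cases "\<sigma> = 1")
  case False
  then show ?thesis
    using z by (intro tendsto_comb_map_off_1) (auto simp: less_imp_le)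
next
  case True
  show ?thesis
  proof (rule tendsto_comb_map[of z \<sigma> _ "min (1/2) (1 / (4 * R))" 0])
    show "\<forall>\<^sub>F n in sequentially. \<forall>m\<ge>0. min (1/2) (1 / (4 * R)) * (1/4) ^ m \<le> cmod (z n - spike_base m)"
      using R(2) by eventually_elim (use horodisc_far_from_spike_base[OF R(1)] True in auto)
  qed (use z R in \<open>auto simp: less_imp_le\<close>)
qed

section \<open>The boundary of the image domain\<close>

definition comb_domain :: "complex set" where
  "comb_domain = comb_map ` ball 0 1"

lemma open_comb_domain: "open comb_domain"
  unfolding comb_domain_def
  using holomorphic_comb_map inj_on_subset[OF inj_on_comb_map, of "ball 0 1"]
  by (intro open_mapping_thm3) auto

text \<open>By the expansion inequality the inverse is 1-Lipschitz, so it extends to the closure.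
  The point 1 is excluded from the inversion formulas because \<open>comb_map\<close> jumps there:
  the limit of the tips is also sent to 1 although it differs from
  \<open>comb_map 1\<close>.\<close>

lemma comb_map_inverse_extension:
  obtains g where "continuous_on (closure comb_domain) g"
    "g ` closure comb_domain \<subseteq> cball 0 1"
    "\<And>x. x \<in> cball 0 1 \<Longrightarrow> x \<noteq> 1 \<Longrightarrow> comb_map x \<in> closure comb_domain \<and> g (comb_map x) = x"
    "\<And>y. y \<in> closure comb_domain \<Longrightarrow> g y \<noteq> 1 \<Longrightarrow> comb_map (g y) = y"
proof -
  define f where "f = inv_into (ball 0 1) comb_map"
  have inj: "inj_on comb_map (ball 0 1)"
    using inj_on_comb_map by (rule inj_on_subset) auto
  have f: "f (comb_map x) = x" if "x \<in> ball 0 1" for x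
    unfolding f_def using inj that by (rule inv_into_f_f)
  have "uniformly_continuous_on comb_domain f"
    unfolding uniformly_continuous_on_def
  proof (intro allI impI exI conjI ballI)
    fix e :: real and y y' assume "e > 0" "y \<in> comb_domain" "y' \<in> comb_domain" "dist y' y < e"
    then obtain x x' where "x \<in> ball 0 1" "x' \<in> ball 0 1" "y = comb_map x" "y' = comb_map x'"
      by (auto simp: comb_domain_def)
    then show "dist (f y') (f y) < e"
      using comb_map_expanding[of x' x] \<open>dist y' y < e\<close> by (simp add: f dist_norm)
  qed
  then obtain g where "uniformly_continuous_on (closure comb_domain) g"
    and gf: "\<And>y. y \<in> comb_domain \<Longrightarrow> f y = g y"
    using uniformly_continuous_on_extension_on_closure by metis
  then have g: "continuous_on (closure comb_domain) g"
    by (simp add: uniformly_continuous_imp_continuous)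
  \<comment> \<open>This ties \<open>g y\<close> to y by points of the disc, so that continuity of
    \<open>comb_map\<close> at \<open>g y\<close> can be used.\<close>
  have gl: "\<exists>x. (\<forall>n. x n \<in> ball 0 1) \<and> x \<longlonglongrightarrow> g y \<and> (\<lambda>n. comb_map (x n)) \<longlonglongrightarrow> y"
    if "y \<in> closure comb_domain" for y
  proof -
    obtain w where w: "\<And>n. w n \<in> comb_domain" "w \<longlonglongrightarrow> y"
      using \<open>y \<in> closure comb_domain\<close> unfolding closure_sequential by blast
    define x where "x n = f (w n)" for n
    have x: "x n \<in> ball 0 1" "comb_map (x n) = w n" for n
      using w(1)[of n] f unfolding x_def comb_domain_def by auto
    have "(\<lambda>n. g (w n)) \<longlonglongrightarrow> g y"
      using w(1) closure_subset[of comb_domain]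
      by (intro continuous_on_tendsto_compose[OF g w(2) that] always_eventually) auto
    then have "x \<longlonglongrightarrow> g y"
      using gf w(1) by (simp add: x_def[abs_def])
    then show ?thesis
      using x w(2) by (intro exI[of _ x]) auto
  qed
  show ?thesis
  proof (rule that[OF g])
    show "g ` closure comb_domain \<subseteq> cball 0 1"
    proof safe
      fix y assume "y \<in> closure comb_domain"
      then obtain x where "\<forall>n. x n \<in> ball 0 1" "x \<longlonglongrightarrow> g y"
        using gl by blast
      then show "g y \<in> cball 0 1"
        by (intro Lim_in_closed_set[of "cball 0 1" x sequentially]) (auto simp: less_imp_le)
    qed
    show "comb_map x \<in> closure comb_domain \<and> g (comb_map x) = x" if "x \<in> cball 0 1" "x \<noteq> 1" for x
    proof -
      \<comment> \<open>Radii below 1 tending to 1: a point of the closed disc is approached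
        radially from inside, where g is known to invert \<open>comb_map\<close>.\<close>
      define r where "r n = 1 - inverse (real (Suc n))" for n
      have r: "0 \<le> r n" "r n < 1" for n
        by (auto simp: r_def field_simps)
      have "r \<longlonglongrightarrow> 1 - 0"
        unfolding r_def by (intro tendsto_intros LIMSEQ_inverse_real_of_nat)
      then have rx: "(\<lambda>n. of_real (r n) * x) \<longlonglongrightarrow> of_real 1 * x"
        by (intro tendsto_intros) simp
      have rb: "of_real (r n) * x \<in> ball 0 1" for n
      proof -
        have "cmod (of_real (r n) * x) \<le> r n * 1"
          unfolding norm_mult using that r[of n] by (intro mult_mono) auto
        then show ?thesis using r[of n] by simp
      qed
      have c: "(\<lambda>n. comb_map (of_real (r n) * x)) \<longlonglongrightarrow> comb_map x"
        using rb rx \<open>x \<noteq> 1\<close> by (intro tendsto_comb_map_off_1) (auto simp: less_imp_le)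
      have d: "comb_map (of_real (r n) * x) \<in> comb_domain" for n
        using rb unfolding comb_domain_def by blast
      have cl: "comb_map x \<in> closure comb_domain"
        unfolding closure_sequential
        by (intro exI[of _ "\<lambda>n. comb_map (of_real (r n) * x)"] conjI allI c d)
      have "(\<lambda>n. g (comb_map (of_real (r n) * x))) \<longlonglongrightarrow> g (comb_map x)"
        using d closure_subset[of comb_domain]
        by (intro continuous_on_tendsto_compose[OF g c cl] always_eventually) auto
      moreover have "g (comb_map (of_real (r n) * x)) = of_real (r n) * x" for n
        using f[OF rb] gf[OF d] by metis
      ultimately show ?thesis
        using cl rx LIMSEQ_unique by auto
    qed
    show "comb_map (g y) = y" if "y \<in> closure comb_domain" "g y \<noteq> 1" for y
    proof -
      obtain x where x: "\<forall>n. x n \<in> ball 0 1" "x \<longlonglongrightarrow> g y" "(\<lambda>n. comb_map (x n)) \<longlonglongrightarrow> y"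
        using gl[OF \<open>y \<in> closure comb_domain\<close>] by blast
      then have "(\<lambda>n. comb_map (x n)) \<longlonglongrightarrow> comb_map (g y)"
        using that by (intro tendsto_comb_map_off_1) (auto simp: less_imp_le)
      then show ?thesis using x(3) LIMSEQ_unique by blast
    qed
  qed
qed

lemma unit_circle_cases_Re:
  assumes "cmod z = 1" "cmod w = 1" "Re z = Re w"
  shows "z = w \<or> z = cnj w"
proof -
  have "(Im z)\<^sup>2 = (Im w)\<^sup>2"
    using assms by (simp add: cmod_def)
  then show ?thesis
    using assms by (auto simp: complex_eq_iff power2_eq_iff)
qed

lemma not_locally_connected_frontier_comb_domain: "\<not> locally connected (frontier comb_domain)"
proof
  assume lc: "locally connected (frontier comb_domain)"
  obtain g where g: "continuous_on (closure comb_domain) g"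
    "g ` closure comb_domain \<subseteq> cball 0 1"
    "\<And>x. x \<in> cball 0 1 \<Longrightarrow> x \<noteq> 1 \<Longrightarrow> comb_map x \<in> closure comb_domain \<and> g (comb_map x) = x"
    "\<And>y. y \<in> closure comb_domain \<Longrightarrow> g y \<noteq> 1 \<Longrightarrow> comb_map (g y) = y"
    using comb_map_inverse_extension by blast
  have fr: "frontier comb_domain = closure comb_domain - comb_domain"
    using open_comb_domain by (simp add: frontier_def interior_open)
  \<comment> \<open>Were \<open>g y\<close> in the open disc, y = \<open>comb_map (g y)\<close>
    would lie in the open set \<open>comb_domain\<close>, away from its frontier.\<close>
  have g_sphere: "cmod (g y) = 1" if "y \<in> frontier comb_domain" for y
  proof (rule ccontr)
    assume *: "cmod (g y) \<noteq> 1"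
    then have "g y \<in> ball 0 1"
      using g(2) that by (force simp: fr)
    moreover have "comb_map (g y) = y"
      using g(4) that * by (metis DiffD1 fr norm_one)
    ultimately show False
      using that using fr by (metis DiffD2 image_eqI comb_domain_def)
  qed
  \<comment> \<open>A connected subset of the frontier joining \<open>p\<close> to the tip of a spike is mapped by \<open>g\<close> to a subset of
    the circle joining 1 to \<open>spike_base n\<close>. It crosses the line through \<open>\<zeta> n\<close> and its conjugate, so the
    subset itself comes near \<open>comb_map 1\<close>.\<close>
  define p where "p = comb_map 1 + 1"
  have base_ne: "spike_base n \<noteq> 1" for n
  proof
    assume "spike_base n = 1"
    then have "(1/4) ^ n \<le> (0::real)"
      using spike_base_far_from_1[of n] by simp
    then show False
      using quarter_power_bounds(1)[of n] by linarith
  qed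
  have tip_frontier: "comb_map (spike_base n) \<in> frontier comb_domain" for n
  proof -
    have "comb_map (spike_base n) \<notin> comb_domain"
    proof
      assume "comb_map (spike_base n) \<in> comb_domain"
      then obtain x where "x \<in> ball 0 1" "comb_map (spike_base n) = comb_map x"
        by (auto simp: comb_domain_def)
      then show False
        using inj_onD[OF inj_on_comb_map, of "spike_base n" x] by force
    qed
    then show ?thesis
      using g(3)[of "spike_base n"] base_ne[of n] by (simp add: fr)
  qed
  have tip: "(\<lambda>n. comb_map (spike_base n)) \<longlonglongrightarrow> p"
    unfolding p_def by (rule comb_map_spike_base_tendsto)
  have p_fr: "p \<in> frontier comb_domain"
    using tip tip_frontier by (intro Lim_in_closed_set[OF frontier_closed _ _ tip]) auto
  have "(\<lambda>n. g (comb_map (spike_base n))) \<longlonglongrightarrow> g p"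
    using tip_frontier p_fr
    by (intro continuous_on_tendsto_compose[OF g(1) tip]) (auto simp: fr)
  moreover have "g (comb_map (spike_base n)) = spike_base n" for n
    using g(3)[of "spike_base n"] base_ne[of n] by simp
  ultimately have gp: "g p = 1"
    using spike_base_tendsto_1 LIMSEQ_unique by auto
  \<comment> \<open>Radius 1/2 since p has distance 1 from \<open>comb_map 1\<close>: a point of U
    within 1/2 of \<open>comb_map 1\<close> is then impossible.\<close>
  have "openin (top_of_set (frontier comb_domain)) (frontier comb_domain \<inter> ball p (1/2))"
    by (rule openin_open_Int) auto
  then obtain U where U: "openin (top_of_set (frontier comb_domain)) U" "connected U" "p \<in> U"
    "U \<subseteq> frontier comb_domain \<inter> ball p (1/2)"
    using lc p_fr unfolding locally_connected by (metis Int_iff centre_in_ball half_gt_zero zero_less_one)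
  obtain T where T: "open T" "U = frontier comb_domain \<inter> T"
    using U(1) by (auto simp: openin_open)
  \<comment> \<open>The real part is the midpoint of those of \<open>spike_base n\<close> and 1. The
    vertical line through it meets the circle in two points, so the conjugate has to be treated as
    well.\<close>
  define \<zeta> where "\<zeta> n = circle_point ((1/4) ^ n / 2)" for n
  have \<zeta>1: "cmod (\<zeta> n) = 1" for n
    unfolding \<zeta>_def using quarter_power_bounds[of n] by (intro norm_circle_point) linarith+
  have \<zeta>_Re: "Re (\<zeta> n) = 1 - (1/4) ^ n / 2" for n
    by (simp add: \<zeta>_def circle_point_def)
  have "(\<lambda>n. (1/4::real) ^ n / 2) \<longlonglongrightarrow> 0 / 2"
    by (intro tendsto_intros LIMSEQ_power_zero) auto
  then have \<zeta>: "\<zeta> \<longlonglongrightarrow> 1"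
    unfolding \<zeta>_def by (intro circle_point_tendsto_1) simp
  have "(\<lambda>n. comb_map (\<zeta> n)) \<longlonglongrightarrow> comb_map 1"
    using \<zeta>1 \<zeta>_Re \<zeta> by (intro comb_map_between_tendsto) auto
  moreover have "(\<lambda>n. comb_map (cnj (\<zeta> n))) \<longlonglongrightarrow> comb_map 1"
    using \<zeta>1 \<zeta>_Re tendsto_cnj[OF \<zeta>] by (intro comb_map_between_tendsto) auto
  ultimately have "\<forall>\<^sub>F n in sequentially. dist (comb_map (\<zeta> n)) (comb_map 1) < 1/2 \<and>
      dist (comb_map (cnj (\<zeta> n))) (comb_map 1) < 1/2 \<and> comb_map (spike_base n) \<in> T"
    using T U(3)
    by (intro eventually_conj topological_tendstoD[OF tip T(1)] tendstoD) auto
  then obtain n where n: "dist (comb_map (\<zeta> n)) (comb_map 1) < 1/2"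
    "dist (comb_map (cnj (\<zeta> n))) (comb_map 1) < 1/2" "comb_map (spike_base n) \<in> T"
    using eventually_happens' sequentially_bot by blast
  have "connected ((\<lambda>y. Re (g y)) ` U)"
    using U(4) by (intro connected_continuous_image U(2) continuous_on_Re continuous_on_subset[OF g(1)])
      (auto simp: fr)
  moreover have "Re (g p) \<in> (\<lambda>y. Re (g y)) ` U"
    using U(3) by blast
  moreover have "Re (g (comb_map (spike_base n))) \<in> (\<lambda>y. Re (g y)) ` U"
    using n(3) tip_frontier T(2) by blast
  ultimately have "1 - (1/4) ^ n / 2 \<in> (\<lambda>y. Re (g y)) ` U"
    using gp g(3)[of "spike_base n"] base_ne[of n] quarter_power_bounds(1)[of n]
    by (elim connectedD_interval[of _ "1 - (1/4) ^ n" 1]) (auto simp: Re_spike_base)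
  then obtain y where y: "y \<in> U" "Re (g y) = Re (\<zeta> n)"
    using \<zeta>_Re by auto
  have y_fr: "y \<in> frontier comb_domain" "dist p y < 1/2"
    using y U(4) by auto
  have "g y \<noteq> 1"
    using y(2) \<zeta>_Re[of n] quarter_power_bounds(1)[of n] by auto
  then have "comb_map (g y) = y"
    using g(4) y_fr by (simp add: fr)
  moreover have "g y = \<zeta> n \<or> g y = cnj (\<zeta> n)"
    using unit_circle_cases_Re[OF g_sphere[OF y_fr(1)] \<zeta>1 y(2)] .
  ultimately have "dist y (comb_map 1) < 1/2"
    using n by auto
  then have "dist p (comb_map 1) < 1"
    using y_fr(2) dist_triangle_half_l[of p y 1 "comb_map 1"] by (simp add: dist_commute)
  then show False
    by (simp add: p_def dist_norm)
qed

section \<open>Wolff's lemma and the Denjoy-Wolff theorem in the disc\<close>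

lemma funpow_in:
  assumes "F ` S \<subseteq> S" "z \<in> S"
  shows "(F ^^ n) z \<in> S"
  using assms by (induction n) auto

text \<open>The reciprocal of the Poisson kernel at \<open>\<sigma>\<close>. As a function it
  expresses the invariance of all horodiscs at once by one inequality.\<close>

definition horo :: "complex \<Rightarrow> complex \<Rightarrow> real" where
  "horo \<sigma> z = (cmod (\<sigma> - z))\<^sup>2 / (1 - (cmod z)\<^sup>2)"

lemma horodisc_iff_horo: "z \<in> horodisc \<sigma> R \<longleftrightarrow> z \<in> ball 0 1 \<and> horo \<sigma> z < R"
  by (simp add: horodisc_def horo_def)

lemma one_minus_norm_power2_pos: "z \<in> ball 0 1 \<Longrightarrow> 0 < 1 - (cmod z)\<^sup>2"
  by (simp add: power_less_one_iff)

lemma horo_nonneg: "z \<in> ball 0 1 \<Longrightarrow> 0 \<le> horo \<sigma> z"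
  using one_minus_norm_power2_pos[of z] by (simp add: horo_def)

lemma continuous_on_horo: "continuous_on (ball 0 1) (horo \<sigma>)"
  unfolding horo_def using one_minus_norm_power2_pos by (intro continuous_intros) force

text \<open>Identifies the limit of the Schwarz-Pick quantity |1 - cnj a * z|, as a tends to a point
  of the circle, with the numerator of \<open>horo\<close>.\<close>

lemma norm_one_minus_cnj_mult:
  assumes "cmod \<sigma> = 1"
  shows "cmod (1 - cnj \<sigma> * z) = cmod (\<sigma> - z)"
proof -
  have "\<sigma> * cnj \<sigma> = 1"
    using assms by (metis complex_norm_square of_real_1 one_power2)
  then have "\<sigma> - z = \<sigma> * (1 - cnj \<sigma> * z)"
    by (simp add: algebra_simps)
  then show ?thesis
    using assms by (simp add: norm_mult)
qed

lemma one_minus_cnj_mult_nonzero: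
  assumes "cmod a < 1" "cmod z \<le> 1"
  shows "1 - cnj a * z \<noteq> 0"
proof
  assume "1 - cnj a * z = 0"
  then have "cmod (cnj a * z) = 1" by simp
  moreover have "cmod (cnj a * z) \<le> cmod a * 1"
    unfolding norm_mult complex_mod_cnj using assms by (intro mult_left_mono) auto
  ultimately show False using assms by simp
qed

lemma one_minus_norm_Moebius:
  assumes "1 - cnj w * z \<noteq> 0"
  shows "1 - (cmod ((z - w) / (1 - cnj w * z)))\<^sup>2
    = (1 - (cmod w)\<^sup>2) * (1 - (cmod z)\<^sup>2) / (cmod (1 - cnj w * z))\<^sup>2"
proof -
  have "(cmod (1 - cnj w * z))\<^sup>2 - (cmod (z - w))\<^sup>2 = (1 - (cmod w)\<^sup>2) * (1 - (cmod z)\<^sup>2)"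
    unfolding cmod_power2 by (simp add: power2_eq_square algebra_simps)
  then show ?thesis
    using assms by (simp add: norm_divide power_divide field_simps)
qed

text \<open>The Schwarz lemma for F composed with the Moebius maps that carry 0 to a and F a to
  0.\<close>

lemma Schwarz_Pick:
  assumes F: "F holomorphic_on ball 0 1" "F ` ball 0 1 \<subseteq> ball 0 1"
    and a: "a \<in> ball 0 1" and z: "z \<in> ball 0 1"
  shows "cmod ((F z - F a) / (1 - cnj (F a) * F z)) \<le> cmod ((z - a) / (1 - cnj a * z))"
proof -
  define \<phi> where "\<phi> = (\<lambda>w. Moebius_function 0 (F a) (F (Moebius_function 0 (- a) w)))"
  have Fa: "cmod (F a) < 1" using F a by force
  have M: "Moebius_function 0 (- a) ` ball 0 1 \<subseteq> ball 0 1"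
    using a Moebius_function_norm_lt_1[of "- a" _ 0] by auto
  have "Moebius_function 0 (- a) holomorphic_on ball 0 1"
    using a by (intro Moebius_function_holomorphic) simp
  then have "(F \<circ> Moebius_function 0 (- a)) holomorphic_on ball 0 1"
    using F(1) M by (rule holomorphic_on_compose_gen)
  then have "(Moebius_function 0 (F a) \<circ> (F \<circ> Moebius_function 0 (- a))) holomorphic_on ball 0 1"
    using M F(2) by (intro holomorphic_on_compose_gen[OF _ Moebius_function_holomorphic[OF Fa]]) auto
  then have "\<phi> holomorphic_on ball 0 1"
    by (simp add: \<phi>_def o_def)
  moreover have "\<phi> 0 = 0"
    by (simp add: \<phi>_def Moebius_function_def)
  moreover have "cmod (\<phi> w) < 1" if "cmod w < 1" for w
    unfolding \<phi>_def using M F(2) that by (intro Moebius_function_norm_lt_1 Fa) force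
  moreover have "cmod (Moebius_function 0 a z) < 1"
    using a z by (intro Moebius_function_norm_lt_1) auto
  ultimately have "cmod (\<phi> (Moebius_function 0 a z)) \<le> cmod (Moebius_function 0 a z)"
    by (rule Schwarz_Lemma(1))
  moreover have "Moebius_function 0 (- a) (Moebius_function 0 a z) = z"
    using a z by (intro Moebius_function_compose) auto
  ultimately show ?thesis
    by (simp add: \<phi>_def Moebius_function_def)
qed

text \<open>Schwarz-Pick at a fixed point, rewritten by the Moebius identity so that the common
  factor 1 - |a|^2 cancels. The remaining inequality does not degenerate as a tends to the
  circle.\<close>

lemma Schwarz_Pick_horo:
  assumes F: "F holomorphic_on ball 0 1" "F ` ball 0 1 \<subseteq> ball 0 1"
    and a: "a \<in> ball 0 1" and z: "z \<in> ball 0 1" and fixed: "F a = a"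
  shows "(cmod (1 - cnj a * F z))\<^sup>2 / (1 - (cmod (F z))\<^sup>2) \<le> (cmod (1 - cnj a * z))\<^sup>2 / (1 - (cmod z)\<^sup>2)"
proof -
  have Fz: "F z \<in> ball 0 1" using F z by blast
  define A where "A = 1 - (cmod a)\<^sup>2"
  define B where "B = 1 - (cmod z)\<^sup>2"
  define C where "C = 1 - (cmod (F z))\<^sup>2"
  define p where "p = (cmod (1 - cnj a * z))\<^sup>2"
  define q where "q = (cmod (1 - cnj a * F z))\<^sup>2"
  have pos: "A > 0" "B > 0" "C > 0"
    unfolding A_def B_def C_def by (intro one_minus_norm_power2_pos a z Fz)+
  have nz: "1 - cnj a * z \<noteq> 0" "1 - cnj a * F z \<noteq> 0"
    using a z Fz one_minus_cnj_mult_nonzero[of a z] one_minus_cnj_mult_nonzero[of a "F z"] by auto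
  then have pq: "p > 0" "q > 0" by (auto simp: p_def q_def)
  have "(cmod ((F z - a) / (1 - cnj a * F z)))\<^sup>2 \<le> (cmod ((z - a) / (1 - cnj a * z)))\<^sup>2"
    using Schwarz_Pick[OF F a z] fixed by (intro power_mono) auto
  then have "A * B / p \<le> A * C / q"
    using one_minus_norm_Moebius[OF nz(1)] one_minus_norm_Moebius[OF nz(2)]
    unfolding A_def B_def C_def p_def q_def by linarith
  then have "B * q \<le> C * p"
    using pos pq by (simp add: field_simps)
  then have "q / C \<le> p / B"
    using pos by (simp add: field_simps)
  then show ?thesis by (simp add: B_def C_def p_def q_def)
qed

text \<open>The contractions r F with r < 1 have fixed points by Brouwer's theorem. A limit point of
  these as r tends to 1 would be a fixed point of F if it were in the open disc, so it lies on the
  circle, and the Schwarz-Pick inequalities at the fixed points pass to the limit.\<close>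

lemma Wolff_lemma:
  assumes F: "F holomorphic_on ball 0 1" "F ` ball 0 1 \<subseteq> ball 0 1"
    and nofix: "\<And>z. z \<in> ball 0 1 \<Longrightarrow> F z \<noteq> z"
  obtains \<sigma> where "cmod \<sigma> = 1" "\<And>z. z \<in> ball 0 1 \<Longrightarrow> horo \<sigma> (F z) \<le> horo \<sigma> z"
proof -
  define r where "r n = 1 - inverse (real (Suc n))" for n
  have r: "0 \<le> r n" "r n < 1" for n
    by (auto simp: r_def field_simps)
  have "r \<longlonglongrightarrow> 1 - 0"
    unfolding r_def by (intro tendsto_intros LIMSEQ_inverse_real_of_nat)
  then have r1: "r \<longlonglongrightarrow> 1" by simp
  have contF: "continuous_on (ball 0 1) F"
    using F(1) by (rule holomorphic_on_imp_continuous_on)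
  have "\<exists>a\<in>ball 0 1. of_real (r n) * F a = a" for n
  proof -
    have sub: "cball 0 (r n) \<subseteq> ball 0 (1::real)" "cball 0 (r n) \<subseteq> ball (0::complex) 1"
      using r[of n] by auto
    have "(\<lambda>z. of_real (r n) * F z) \<in> cball 0 (r n) \<rightarrow> cball 0 (r n)"
    proof
      fix z :: complex assume "z \<in> cball 0 (r n)"
      then have "cmod (F z) < 1" using sub F(2) by force
      then have "r n * cmod (F z) \<le> r n * 1"
        using r[of n] by (intro mult_left_mono) auto
      then show "of_real (r n) * F z \<in> cball 0 (r n)"
        using r[of n] by (simp add: norm_mult)
    qed
    moreover have "continuous_on (cball 0 (r n)) (\<lambda>z. of_real (r n) * F z)"
      by (intro continuous_intros continuous_on_subset[OF contF] sub)
    ultimately obtain a where "a \<in> cball 0 (r n)" "of_real (r n) * F a = a"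
      using brouwer[of "cball (0::complex) (r n)" "\<lambda>z. of_real (r n) * F z"] r[of n] by auto
    then show ?thesis using sub by blast
  qed
  then obtain a where a: "\<And>n. a n \<in> ball 0 1" "\<And>n. of_real (r n) * F (a n) = a n"
    by metis
  have "\<forall>n. a n \<in> cball 0 1"
    using a(1) by (auto simp: less_imp_le)
  then obtain \<sigma> s where s: "\<sigma> \<in> cball 0 1" "strict_mono s" "(a \<circ> s) \<longlonglongrightarrow> \<sigma>"
    using compact_cball[of "0::complex" 1] unfolding compact_def by metis
  have rs: "(\<lambda>n. complex_of_real (r (s n))) \<longlonglongrightarrow> of_real 1"
    using LIMSEQ_subseq_LIMSEQ[OF r1 s(2)] by (intro tendsto_of_real) (simp add: o_def)
  have \<sigma>: "cmod \<sigma> = 1"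
  proof (rule ccontr)
    assume "cmod \<sigma> \<noteq> 1"
    then have \<sigma>b: "\<sigma> \<in> ball 0 1" using s(1) by auto
    have "(\<lambda>n. F ((a \<circ> s) n)) \<longlonglongrightarrow> F \<sigma>"
      using a(1) by (intro continuous_on_tendsto_compose[OF contF s(3) \<sigma>b]) auto
    then have "(\<lambda>n. complex_of_real (r (s n)) * F ((a \<circ> s) n)) \<longlonglongrightarrow> of_real 1 * F \<sigma>"
      by (intro tendsto_mult rs)
    then have "(a \<circ> s) \<longlonglongrightarrow> F \<sigma>"
      using a(2) by (simp add: o_def)
    then show False
      using LIMSEQ_unique[OF s(3)] nofix[OF \<sigma>b] by metis
  qed
  moreover have "horo \<sigma> (F z) \<le> horo \<sigma> z" if z: "z \<in> ball 0 1" for z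
  proof -
    have Fz: "F z \<in> ball 0 1" using F(2) z by blast
    have le: "(cmod (1 - cnj (a n) * (of_real (r n) * F z)))\<^sup>2 / (1 - (cmod (of_real (r n) * F z))\<^sup>2)
        \<le> (cmod (1 - cnj (a n) * z))\<^sup>2 / (1 - (cmod z)\<^sup>2)" for n
    proof (rule Schwarz_Pick_horo[of "\<lambda>z. of_real (r n) * F z", OF _ _ a(1) z a(2)])
      show "(\<lambda>z. of_real (r n) * F z) holomorphic_on ball 0 1"
        by (intro holomorphic_intros F)
      show "(\<lambda>z. of_real (r n) * F z) ` ball 0 1 \<subseteq> ball 0 1"
      proof safe
        fix z :: complex assume "z \<in> ball 0 1"
        then have "cmod (F z) < 1" using F(2) by force
        then have "r n * cmod (F z) \<le> r n * 1"
          using r[of n] by (intro mult_left_mono) auto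
        then show "of_real (r n) * F z \<in> ball 0 1"
          using r[of n] by (simp add: norm_mult)
      qed
    qed
    have "(\<lambda>n. (cmod (1 - cnj ((a \<circ> s) n) * z))\<^sup>2 / (1 - (cmod z)\<^sup>2))
        \<longlonglongrightarrow> (cmod (1 - cnj \<sigma> * z))\<^sup>2 / (1 - (cmod z)\<^sup>2)"
      using one_minus_norm_power2_pos[OF z] by (intro tendsto_intros s(3)) auto
    moreover have "(\<lambda>n. (cmod (1 - cnj ((a \<circ> s) n) * (of_real (r (s n)) * F z)))\<^sup>2
          / (1 - (cmod (of_real (r (s n)) * F z))\<^sup>2))
        \<longlonglongrightarrow> (cmod (1 - cnj \<sigma> * (of_real 1 * F z)))\<^sup>2 / (1 - (cmod (of_real 1 * F z))\<^sup>2)"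
      using one_minus_norm_power2_pos[OF Fz] by (intro tendsto_intros s(3) rs) auto
    ultimately have "(cmod (1 - cnj \<sigma> * (of_real 1 * F z)))\<^sup>2 / (1 - (cmod (of_real 1 * F z))\<^sup>2)
        \<le> (cmod (1 - cnj \<sigma> * z))\<^sup>2 / (1 - (cmod z)\<^sup>2)"
      using le[of "s _"] by (intro LIMSEQ_le) auto
    then show ?thesis
      by (simp add: horo_def norm_one_minus_cnj_mult[OF \<sigma>])
  qed
  ultimately show ?thesis using that by blast
qed

section \<open>Half-plane model and convergence of orbits\<close>

definition cayley :: "complex \<Rightarrow> complex \<Rightarrow> complex" where
  "cayley \<sigma> z = (\<sigma> + z) / (\<sigma> - z)"

text \<open>In the right half-plane with \<open>\<sigma>\<close> at infinity, horodiscs become the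
  half-planes Re > 1/R. For z on the circle both sides are 0, with x / 0 = 0.\<close>

lemma Re_cayley:
  assumes "cmod \<sigma> = 1"
  shows "Re (cayley \<sigma> z) = 1 / horo \<sigma> z"
proof -
  have "Re ((\<sigma> + z) * cnj (\<sigma> - z)) = (cmod \<sigma>)\<^sup>2 - (cmod z)\<^sup>2"
    unfolding cmod_power2 by (simp add: power2_eq_square algebra_simps)
  moreover have "cayley \<sigma> z = (\<sigma> + z) * cnj (\<sigma> - z) / of_real ((cmod (\<sigma> - z))\<^sup>2)"
    unfolding cayley_def by (metis complex_div_cnj of_real_power)
  ultimately show ?thesis
    using assms by (simp add: horo_def del: of_real_power complex_cnj_diff)
qed

lemma cayley_plus_1:
  assumes "\<sigma> \<noteq> z"
  shows "cayley \<sigma> z + 1 = 2 * \<sigma> / (\<sigma> - z)"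
  using assms by (simp add: cayley_def field_simps)

text \<open>In the half-plane the orbit is an arithmetic progression with step b, which runs off to
  infinity. The formula for \<open>cayley \<sigma> z + 1\<close> translates this back into
  \<open>\<sigma>\<close> - z tending to 0.\<close>

lemma parabolic_orbit_tendsto:
  assumes \<sigma>: "cmod \<sigma> = 1" and F: "F ` ball 0 1 \<subseteq> ball 0 1"
    and b: "b \<noteq> 0" "\<And>z. z \<in> ball 0 1 \<Longrightarrow> cayley \<sigma> (F z) = cayley \<sigma> z + b" and z: "z \<in> ball 0 1"
  shows "(\<lambda>n. (F ^^ n) z) \<longlonglongrightarrow> \<sigma>"
proof -
  have orb: "(F ^^ n) z \<in> ball 0 1" for n
    using F z by (rule funpow_in)
  have c: "cayley \<sigma> ((F ^^ n) z) = cayley \<sigma> z + of_nat n * b" for n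
    using orb by (induction n) (auto simp: b(2) algebra_simps simp del: mem_ball)
  have "filterlim (\<lambda>n. b * of_nat n) at_infinity sequentially"
    using b(1) by (intro tendsto_mult_filterlim_at_infinity[OF tendsto_const _ tendsto_of_nat])
  then have "filterlim (\<lambda>n. (cayley \<sigma> z + 1) + b * of_nat n) at_infinity sequentially"
    by (rule tendsto_add_filterlim_at_infinity[OF tendsto_const])
  then have "filterlim (\<lambda>n. cayley \<sigma> z + 1 + of_nat n * b) at_infinity sequentially"
    by (simp add: mult.commute)
  then have "(\<lambda>n. 2 * \<sigma> / (cayley \<sigma> z + 1 + of_nat n * b)) \<longlonglongrightarrow> 0"
    by (intro tendsto_divide_0[OF tendsto_const])
  moreover have "2 * \<sigma> / (cayley \<sigma> z + 1 + of_nat n * b) = \<sigma> - (F ^^ n) z" for n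
  proof -
    have "\<sigma> \<noteq> (F ^^ n) z" using orb[of n] \<sigma> by auto
    moreover have "\<sigma> \<noteq> 0" using \<sigma> by auto
    moreover have "cayley \<sigma> z + 1 + of_nat n * b = cayley \<sigma> ((F ^^ n) z) + 1"
      by (simp add: c)
    ultimately show ?thesis
      by (simp add: cayley_plus_1)
  qed
  ultimately have "(\<lambda>n. \<sigma> - (F ^^ n) z) \<longlonglongrightarrow> 0" by simp
  from tendsto_diff[OF tendsto_const[of \<sigma>] this] show ?thesis by simp
qed

text \<open>In the half-plane model \<open>F\<close> never decreases the real part. If it preserves the real part at a single
  point, the open mapping theorem makes it a vertical translation.\<close>

lemma horo_equality_imp_parabolic:
  assumes F: "F holomorphic_on ball 0 1" "F ` ball 0 1 \<subseteq> ball 0 1"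
    and nofix: "\<And>z. z \<in> ball 0 1 \<Longrightarrow> F z \<noteq> z"
    and \<sigma>: "cmod \<sigma> = 1" "\<And>z. z \<in> ball 0 1 \<Longrightarrow> horo \<sigma> (F z) \<le> horo \<sigma> z"
    and p: "p \<in> ball 0 1" "horo \<sigma> (F p) = horo \<sigma> p"
  obtains b where "b \<noteq> 0" "\<And>z. z \<in> ball 0 1 \<Longrightarrow> cayley \<sigma> (F z) = cayley \<sigma> z + b"
proof -
  define q where "q z = cayley \<sigma> (F z) - cayley \<sigma> z" for z
  have ne: "\<sigma> \<noteq> z" if "z \<in> ball 0 1" for z using that \<sigma> by auto
  have FB: "F z \<in> ball 0 1" if "z \<in> ball 0 1" for z
    using F(2) that by blast
  have hol: "q holomorphic_on ball 0 1"
    unfolding q_def cayley_def using ne FB by (intro holomorphic_intros F(1)) (metis right_minus_eq)+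
  have Re: "Re (q z) \<ge> 0" if "z \<in> ball 0 1" for z
  proof -
    have "horo \<sigma> (F z) > 0"
      using ne[OF FB[OF that]] one_minus_norm_power2_pos[OF FB[OF that]] by (simp add: horo_def)
    then show ?thesis
      using \<sigma>(2)[OF that] by (simp add: q_def Re_cayley[OF \<sigma>(1)] frac_le)
  qed
  have "Re (q p) = 0"
    using p by (simp add: q_def Re_cayley[OF \<sigma>(1)])
  have "q constant_on ball 0 1"
  proof (rule ccontr)
    assume "\<not> q constant_on ball 0 1"
    then have "open (q ` ball 0 1)"
      using hol by (intro open_mapping_thm[of q "ball 0 1"]) auto
    then obtain e where e: "e > 0" "ball (q p) e \<subseteq> q ` ball 0 1"
      using p(1) by (meson imageI open_contains_ball)
    \<comment> \<open>A value straight to the left of \<open>q p\<close>, where the real part would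
      be negative.\<close>
    have "q p - of_real (e / 2) \<in> ball (q p) e"
      using e by (simp add: dist_norm)
    then obtain z where "z \<in> ball 0 1" "q z = q p - of_real (e / 2)"
      using e by (metis imageE subsetD)
    then show False
      using Re[of z] \<open>Re (q p) = 0\<close> e by simp
  qed
  then obtain b where b: "\<And>z. z \<in> ball 0 1 \<Longrightarrow> q z = b"
    unfolding constant_on_def by blast
  have "b \<noteq> 0"
  proof
    assume "b = 0"
    then have "cayley \<sigma> (F 0) = cayley \<sigma> 0"
      using b[of 0] by (simp add: q_def)
    moreover have "\<sigma> \<noteq> F 0" "\<sigma> \<noteq> 0"
      using ne[OF FB[of 0]] ne[of 0] by auto
    ultimately have "F 0 = 0"
      by (simp add: cayley_def field_simps)
    then show False using nofix[of 0] by simp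
  qed
  moreover have "cayley \<sigma> (F z) = cayley \<sigma> z + b" if "z \<in> ball 0 1" for z
    using b[OF that] by (simp add: q_def algebra_simps)
  ultimately show ?thesis using that by blast
qed

text \<open>Along the orbit \<open>horo\<close> decreases to a limit l. A subsequential limit p
  other than \<open>\<sigma>\<close> cannot lie on the circle, which closed horodiscs touch only at
  \<open>\<sigma>\<close>. If p is inside, continuity gives \<open>horo\<close> the value l at both
  p and F p; this equality forces the parabolic case, where orbits do converge to
  \<open>\<sigma>\<close>.\<close>

lemma Denjoy_Wolff_pointwise:
  assumes F: "F holomorphic_on ball 0 1" "F ` ball 0 1 \<subseteq> ball 0 1"
    and nofix: "\<And>z. z \<in> ball 0 1 \<Longrightarrow> F z \<noteq> z"
    and \<sigma>: "cmod \<sigma> = 1" "\<And>z. z \<in> ball 0 1 \<Longrightarrow> horo \<sigma> (F z) \<le> horo \<sigma> z"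
    and z: "z \<in> ball 0 1"
  shows "(\<lambda>n. (F ^^ n) z) \<longlonglongrightarrow> \<sigma>"
proof (rule ccontr)
  assume *: "\<not> (\<lambda>n. (F ^^ n) z) \<longlonglongrightarrow> \<sigma>"
  define x where "x n = (F ^^ n) z" for n
  have orb: "x n \<in> ball 0 1" for n
    unfolding x_def using F(2) z by (rule funpow_in)
  have dec: "decseq (\<lambda>n. horo \<sigma> (x n))"
    unfolding decseq_Suc_iff using \<sigma>(2)[OF orb] by (simp add: x_def)
  obtain l where l: "(\<lambda>n. horo \<sigma> (x n)) \<longlonglongrightarrow> l"
    using decseq_convergent[OF dec, of 0] horo_nonneg[OF orb] by blast
  obtain e where e: "e > 0" "\<not> (\<forall>\<^sub>F n in sequentially. dist (x n) \<sigma> < e)"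
    using * unfolding tendsto_iff x_def by blast
  obtain s :: "nat \<Rightarrow> nat" where s: "strict_mono s" "\<And>n. \<not> dist (x (s n)) \<sigma> < e"
    using not_eventually_sequentiallyD[OF e(2)] by blast
  have "\<forall>n. (x \<circ> s) n \<in> cball 0 1"
    using orb by (auto simp: less_imp_le)
  then obtain p t where t: "p \<in> cball 0 1" "strict_mono t" "((x \<circ> s) \<circ> t) \<longlonglongrightarrow> p"
    using compact_cball[of "0::complex" 1] unfolding compact_def by metis
  define u where "u = s \<circ> t"
  have u: "strict_mono u" "(\<lambda>n. x (u n)) \<longlonglongrightarrow> p" "\<And>n. dist (x (u n)) \<sigma> \<ge> e"
    unfolding u_def using strict_mono_o[OF s(1) t(2)] s(2) t(3) by (auto simp: o_def not_less)
  have "dist p \<sigma> \<ge> e"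
    by (rule tendsto_lowerbound[OF tendsto_dist[OF u(2) tendsto_const]]) (use u(3) in auto)
  then have "p \<noteq> \<sigma>" using e by auto
  have "p \<in> ball 0 1"
  proof (rule ccontr)
    assume "p \<notin> ball 0 1"
    then have p1: "cmod p = 1" using t(1) by auto
    \<comment> \<open>The denominator is cleared because it tends to 0 when p is on the
      circle.\<close>
    have "(cmod (\<sigma> - x n))\<^sup>2 \<le> horo \<sigma> z * (1 - (cmod (x n))\<^sup>2)" for n
    proof -
      have "horo \<sigma> (x n) \<le> horo \<sigma> (x 0)"
        using dec by (simp add: decseq_def)
      then show ?thesis
        using one_minus_norm_power2_pos[OF orb[of n]] by (simp add: x_def horo_def[of \<sigma> "(F ^^ n) z"] field_simps)
    qed
    moreover have "(\<lambda>n. (cmod (\<sigma> - x (u n)))\<^sup>2) \<longlonglongrightarrow> (cmod (\<sigma> - p))\<^sup>2"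
      by (intro tendsto_intros u)
    moreover have "(\<lambda>n. horo \<sigma> z * (1 - (cmod (x (u n)))\<^sup>2)) \<longlonglongrightarrow> horo \<sigma> z * (1 - (cmod p)\<^sup>2)"
      by (intro tendsto_intros u)
    ultimately have "(cmod (\<sigma> - p))\<^sup>2 \<le> horo \<sigma> z * (1 - (cmod p)\<^sup>2)"
      by (intro LIMSEQ_le) auto
    then show False using p1 \<open>p \<noteq> \<sigma>\<close> by simp
  qed
  have "(\<lambda>n. horo \<sigma> (x (u n))) \<longlonglongrightarrow> horo \<sigma> p"
    using orb by (intro continuous_on_tendsto_compose[OF continuous_on_horo u(2) \<open>p \<in> ball 0 1\<close>]) auto
  moreover have "(\<lambda>n. horo \<sigma> (x (u n))) \<longlonglongrightarrow> l"
    using LIMSEQ_subseq_LIMSEQ[OF l u(1)] by (simp add: o_def)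
  ultimately have 1: "horo \<sigma> p = l" using LIMSEQ_unique by blast
  have Fp: "F p \<in> ball 0 1" using F(2) \<open>p \<in> ball 0 1\<close> by blast
  have "(\<lambda>n. F (x (u n))) \<longlonglongrightarrow> F p"
    using orb by (intro continuous_on_tendsto_compose[OF holomorphic_on_imp_continuous_on[OF F(1)] u(2) \<open>p \<in> ball 0 1\<close>]) auto
  then have "(\<lambda>n. horo \<sigma> (F (x (u n)))) \<longlonglongrightarrow> horo \<sigma> (F p)"
    using orb F(2)
    by (intro continuous_on_tendsto_compose[OF continuous_on_horo _ Fp] always_eventually allI) blast+
  moreover have "(\<lambda>n. horo \<sigma> (F (x (u n)))) \<longlonglongrightarrow> l"
  proof -
    have "(\<lambda>n. horo \<sigma> (x (Suc n))) \<longlonglongrightarrow> l"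
      using l by (rule LIMSEQ_Suc)
    from LIMSEQ_subseq_LIMSEQ[OF this u(1)] show ?thesis
      by (simp add: o_def x_def)
  qed
  ultimately have "horo \<sigma> (F p) = horo \<sigma> p" using 1 LIMSEQ_unique by blast
  then obtain b where "b \<noteq> 0" "\<And>z. z \<in> ball 0 1 \<Longrightarrow> cayley \<sigma> (F z) = cayley \<sigma> z + b"
    using horo_equality_imp_parabolic[OF F nofix \<sigma> \<open>p \<in> ball 0 1\<close>] by blast
  then show False
    using parabolic_orbit_tendsto[OF \<sigma>(1) F(2) _ _ z] * by blast
qed

section \<open>Domains with horospheric limits\<close>

text \<open>The right-hand side is independent of F, so one estimate makes all iterates
  equicontinuous. The factor 2 bounds the denominator in the Schwarz-Pick quotient.\<close>

lemma Schwarz_Pick_dist: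
  assumes F: "F holomorphic_on ball 0 1" "F ` ball 0 1 \<subseteq> ball 0 1"
    and a: "a \<in> ball 0 1" and z: "z \<in> ball 0 1"
  shows "cmod (F z - F a) \<le> 2 * cmod ((z - a) / (1 - cnj a * z))"
proof -
  have b: "cmod (F z) < 1" "cmod (F a) < 1"
    using F(2) a z by force+
  have nz: "1 - cnj (F a) * F z \<noteq> 0"
    using b by (intro one_minus_cnj_mult_nonzero) auto
  have "cmod (cnj (F a) * F z) \<le> 1 * 1"
    unfolding norm_mult complex_mod_cnj using b by (intro mult_mono) auto
  then have "cmod (1 - cnj (F a) * F z) \<le> 2"
    using norm_triangle_ineq4[of 1 "cnj (F a) * F z"] by simp
  then have "cmod (F z - F a) \<le> cmod ((F z - F a) / (1 - cnj (F a) * F z)) * 2"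
    using nz mult_left_mono[of "cmod (1 - cnj (F a) * F z)" 2 "cmod (F z - F a)"]
    by (simp add: norm_divide pos_le_divide_eq)
  also have "\<dots> \<le> cmod ((z - a) / (1 - cnj a * z)) * 2"
    using Schwarz_Pick[OF F a z] by (intro mult_right_mono) auto
  finally show ?thesis by simp
qed

lemma holomorphic_on_funpow:
  assumes "F holomorphic_on S" "F ` S \<subseteq> S"
  shows "(F ^^ n) holomorphic_on S"
proof (induction n)
  case (Suc n)
  have "(F ^^ n) ` S \<subseteq> S"
    using funpow_in[OF assms(2)] by blast
  then show ?case
    using holomorphic_on_compose_gen[OF Suc assms(1)] by (simp add: o_def)
qed (simp add: id_def)

text \<open>Locally uniform convergence in sequential form: equicontinuity of the iterates lets the
  starting points move towards a.\<close>

lemma Denjoy_Wolff_sequence: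
  assumes F: "F holomorphic_on ball 0 1" "F ` ball 0 1 \<subseteq> ball 0 1"
    and nofix: "\<And>z. z \<in> ball 0 1 \<Longrightarrow> F z \<noteq> z"
    and \<sigma>: "cmod \<sigma> = 1" "\<And>z. z \<in> ball 0 1 \<Longrightarrow> horo \<sigma> (F z) \<le> horo \<sigma> z"
    and r: "strict_mono r" and x: "\<And>n. x n \<in> ball 0 1" "x \<longlonglongrightarrow> a" "a \<in> ball 0 1"
  shows "(\<lambda>n. (F ^^ r n) (x n)) \<longlonglongrightarrow> \<sigma>"
proof -
  have 1: "(\<lambda>n. (F ^^ r n) a) \<longlonglongrightarrow> \<sigma>"
    using LIMSEQ_subseq_LIMSEQ[OF Denjoy_Wolff_pointwise[OF F nofix \<sigma> x(3)] r] by (simp add: o_def)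
  have "(\<lambda>n. (F ^^ r n) (x n) - (F ^^ r n) a) \<longlonglongrightarrow> 0"
  proof (rule tendsto_norm_zero_cancel, rule tendsto_sandwich[OF _ _ tendsto_const])
    have "1 - cnj a * a \<noteq> 0"
      using x(3) by (intro one_minus_cnj_mult_nonzero) auto
    then have "(\<lambda>n. 2 * cmod ((x n - a) / (1 - cnj a * x n))) \<longlonglongrightarrow> 2 * cmod ((a - a) / (1 - cnj a * a))"
      by (intro tendsto_intros x(2)) auto
    then show "(\<lambda>n. 2 * cmod ((x n - a) / (1 - cnj a * x n))) \<longlonglongrightarrow> 0"
      by simp
    show "\<forall>\<^sub>F n in sequentially. norm ((F ^^ r n) (x n) - (F ^^ r n) a)
        \<le> 2 * cmod ((x n - a) / (1 - cnj a * x n))"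
      using funpow_in[OF F(2)]
      by (intro always_eventually allI Schwarz_Pick_dist holomorphic_on_funpow F x image_subsetI)
  qed auto
  from tendsto_add[OF this 1] show ?thesis by simp
qed

text \<open>H-limits at all boundary points with finite values. L is chosen before R, so one value
  serves horodiscs of every size.\<close>

definition horospheric_limits :: "(complex \<Rightarrow> complex) \<Rightarrow> bool" where
  "horospheric_limits h \<longleftrightarrow> (\<forall>\<sigma>\<in>sphere 0 1. \<exists>L. \<forall>z R. (\<forall>n. z n \<in> ball 0 1) \<longrightarrow> z \<longlonglongrightarrow> \<sigma> \<longrightarrow>
     R > 0 \<longrightarrow> (\<forall>\<^sub>F n in sequentially. z n \<in> horodisc \<sigma> R) \<longrightarrow> (\<lambda>n. h (z n)) \<longlonglongrightarrow> L)"

lemma openin_riemann_sphere_imp_open: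
  assumes "openin riemann_sphere U"
  shows "open {w. Some w \<in> U}"
  using assms unfolding openin_Alexandroff_compactification
  by (auto simp: image_iff intro: open_Compl[unfolded Compl_eq])

lemma limitin_riemann_sphere_Some:
  assumes "(f \<longlongrightarrow> l) F"
  shows "limitin riemann_sphere (\<lambda>x. Some (f x)) (Some l) F"
  unfolding limitin_def
proof (intro conjI allI impI)
  fix U assume U: "openin riemann_sphere U \<and> Some l \<in> U"
  then have "\<forall>\<^sub>F x in F. f x \<in> {w. Some w \<in> U}"
    using assms openin_riemann_sphere_imp_open by (intro topological_tendstoD) auto
  then show "\<forall>\<^sub>F x in F. Some (f x) \<in> U" by simp
qed simp

lemma Some_in_frontier_of:
  assumes "L \<in> closure D" "L \<notin> D"
  shows "Some L \<in> riemann_sphere frontier_of (Some ` D)"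
proof -
  have "Some L \<in> riemann_sphere closure_of (Some ` D)"
    unfolding in_closure_of
  proof (intro conjI allI impI)
    fix T assume T: "Some L \<in> T \<and> openin riemann_sphere T"
    then have "{w. Some w \<in> T} \<inter> closure D \<noteq> {}"
      using assms by blast
    then have "{w. Some w \<in> T} \<inter> D \<noteq> {}"
      using open_Int_closure_eq_empty[OF openin_riemann_sphere_imp_open] T by blast
    then show "\<exists>y. y \<in> Some ` D \<and> y \<in> T" by blast
  qed simp
  moreover have "Some L \<notin> riemann_sphere interior_of (Some ` D)"
    using interior_of_subset[of riemann_sphere "Some ` D"] assms(2) by auto
  ultimately show ?thesis
    by (simp add: frontier_of_def)
qed

lemma denjoy_wolff_property_if_horospheric_limits:
  assumes h: "h holomorphic_on ball 0 1" "inj_on h (ball 0 1)" "horospheric_limits h"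
  shows "denjoy_wolff_property (h ` ball 0 1)"
  unfolding denjoy_wolff_property_def
proof (intro allI impI, elim conjE)
  define D where "D = h ` ball 0 1"
  fix f assume "f holomorphic_on h ` ball 0 1" "f ` h ` ball 0 1 \<subseteq> h ` ball 0 1"
    and "\<forall>z\<in>h ` ball 0 1. f z \<noteq> z"
  then have f: "f holomorphic_on D" "f ` D \<subseteq> D" "\<And>z. z \<in> D \<Longrightarrow> f z \<noteq> z"
    by (auto simp: D_def)
  obtain g where g: "g holomorphic_on D" "\<And>z. z \<in> ball 0 1 \<Longrightarrow> g (h z) = z"
    using holomorphic_has_inverse[OF h(1) open_ball h(2)] unfolding D_def by metis
  have hg: "h (g y) = y" "g y \<in> ball 0 1" if "y \<in> D" for y
    using that g(2) by (auto simp: D_def)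
  have hD: "h z \<in> D" if "z \<in> ball 0 1" for z
    using that by (simp add: D_def)
  define F where "F = (\<lambda>z. g (f (h z)))"
  have F: "F holomorphic_on ball 0 1" "F ` ball 0 1 \<subseteq> ball 0 1"
  proof -
    have "(g \<circ> (f \<circ> h)) holomorphic_on ball 0 1"
      using f hD by (intro holomorphic_on_compose_gen[OF _ g(1)] holomorphic_on_compose_gen[OF h(1) f(1)]) auto
    then show "F holomorphic_on ball 0 1" by (simp add: F_def o_def)
    show "F ` ball 0 1 \<subseteq> ball 0 1"
      unfolding F_def using f(2) hD hg by blast
  qed
  have hF: "h (F z) = f (h z)" if "z \<in> ball 0 1" for z
    using f(2) hD[OF that] hg unfolding F_def by blast
  have nofix: "F z \<noteq> z" if "z \<in> ball 0 1" for z
    using hF[OF that] f(3)[OF hD[OF that]] by metis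
  have orb: "(F ^^ n) z \<in> ball 0 1" if "z \<in> ball 0 1" for n z
    using F(2) that by (rule funpow_in)
  have iter: "h ((F ^^ n) z) = (f ^^ n) (h z)" if "z \<in> ball 0 1" for n z
    by (induction n) (use hF orb[OF that] in auto)
  obtain \<sigma> where \<sigma>: "cmod \<sigma> = 1" "\<And>z. z \<in> ball 0 1 \<Longrightarrow> horo \<sigma> (F z) \<le> horo \<sigma> z"
    using Wolff_lemma[OF F nofix] by blast
  have horo_iter: "horo \<sigma> ((F ^^ n) z) \<le> horo \<sigma> z" if "z \<in> ball 0 1" for n z
    by (induction n) (use \<sigma>(2) orb[OF that] order_trans in \<open>fastforce+\<close>)
  obtain L where L: "(\<lambda>n. h (z n)) \<longlonglongrightarrow> L"
    if "\<forall>n. z n \<in> ball 0 1" "z \<longlonglongrightarrow> \<sigma>" "R > 0" "\<forall>\<^sub>F n in sequentially. z n \<in> horodisc \<sigma> R" for z R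
  proof -
    have "\<sigma> \<in> sphere 0 1" using \<sigma> by simp
    then show ?thesis using h(3) that unfolding horospheric_limits_def by meson
  qed
  have z0: "(0::complex) \<in> ball 0 1" by simp
  have lim0: "(\<lambda>n. (F ^^ n) 0) \<longlonglongrightarrow> \<sigma>"
    using Denjoy_Wolff_pointwise[OF F nofix \<sigma> z0] .
  have hL: "(\<lambda>n. h ((F ^^ n) 0)) \<longlonglongrightarrow> L"
  proof (rule L[OF _ lim0])
    show "\<forall>n. (F ^^ n) 0 \<in> ball 0 1" using orb[OF z0] by blast
    \<comment> \<open>The added 1 turns the weak inequality of Wolff's lemma into the strict one
      that defines a horodisc.\<close>
    show "0 < horo \<sigma> 0 + 1" using horo_nonneg[OF z0, of \<sigma>] by simp
    show "\<forall>\<^sub>F n in sequentially. (F ^^ n) 0 \<in> horodisc \<sigma> (horo \<sigma> 0 + 1)"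
      using orb[OF z0] le_less_trans[OF horo_iter[OF z0], of "horo \<sigma> 0 + 1"]
      unfolding horodisc_iff_horo by (intro always_eventually allI conjI) auto
  qed
  have "L \<in> closure D"
    unfolding closure_sequential using hL hD[OF orb[OF z0]]
    by (intro exI[of _ "\<lambda>n. h ((F ^^ n) 0)"]) blast
  \<comment> \<open>If L were in D, continuity of g there would make the orbit of 0 converge inside
    the disc instead of to \<open>\<sigma>\<close>.\<close>
  moreover have "L \<notin> D"
  proof
    assume LD: "L \<in> D"
    have "(\<lambda>n. g (h ((F ^^ n) 0))) \<longlonglongrightarrow> g L"
      using hD[OF orb[OF z0]]
      by (intro continuous_on_tendsto_compose[OF holomorphic_on_imp_continuous_on[OF g(1)] hL LD]) auto
    then have "(\<lambda>n. (F ^^ n) 0) \<longlonglongrightarrow> g L"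
      using g(2)[OF orb[OF z0]] by simp
    then have "g L = \<sigma>" using lim0 LIMSEQ_unique by blast
    then show False using hg(2)[OF LD] \<sigma>(1) by simp
  qed
  ultimately have "Some L \<in> riemann_sphere frontier_of (Some ` D)"
    by (rule Some_in_frontier_of)
  moreover have "\<forall>\<^sub>F n in sequentially. \<forall>z\<in>K. chordal_dist (Some ((f ^^ n) z)) (Some L) < e"
    if K: "compact K" "K \<subseteq> D" and "e > 0" for K e
  proof (rule ccontr)
    assume "\<not> ?thesis"
    then have "\<exists>r::nat \<Rightarrow> nat. strict_mono r \<and>
        (\<forall>n. \<not> (\<forall>z\<in>K. chordal_dist (Some ((f ^^ r n) z)) (Some L) < e))"
      by (rule not_eventually_sequentiallyD)
    then obtain r :: "nat \<Rightarrow> nat" where r: "strict_mono r"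
      "\<And>n. \<exists>z\<in>K. \<not> chordal_dist (Some ((f ^^ r n) z)) (Some L) < e"
      by blast
    then obtain y where y: "\<And>n. y n \<in> K" "\<And>n. \<not> chordal_dist (Some ((f ^^ r n) (y n))) (Some L) < e"
      by metis
    have K': "compact (g ` K)" "g ` K \<subseteq> ball 0 1"
      using K hg by (auto intro!: compact_continuous_image
          continuous_on_subset[OF holomorphic_on_imp_continuous_on[OF g(1)]])
    have "\<forall>n. g (y n) \<in> g ` K" using y by blast
    then obtain a s where s: "a \<in> g ` K" "strict_mono s" "((\<lambda>n. g (y n)) \<circ> s) \<longlonglongrightarrow> a"
      using K'(1) unfolding compact_def by metis
    define x where "x n = g (y (s n))" for n
    have x: "x n \<in> g ` K" "x n \<in> ball 0 1" "h (x n) = y (s n)" for n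
      using y(1)[of "s n"] K hg by (auto simp: x_def)
    \<comment> \<open>Boundedness of \<open>horo\<close> on the compact set of starting points puts
      all their orbits into one horodisc.\<close>
    have "compact (horo \<sigma> ` (g ` K))"
      using K' by (intro compact_continuous_image[OF continuous_on_subset[OF continuous_on_horo]])
    then have "bounded (horo \<sigma> ` (g ` K))"
      by (rule compact_imp_bounded)
    then obtain B where B: "B > 0" "\<And>w. w \<in> g ` K \<Longrightarrow> horo \<sigma> w \<le> B"
      unfolding bounded_pos by (auto simp: abs_le_iff)
    define w where "w n = (F ^^ r (s n)) (x n)" for n
    have w: "w n \<in> ball 0 1" for n
      unfolding w_def by (rule orb[OF x(2)])
    have "w \<longlonglongrightarrow> \<sigma>"
      unfolding w_def
    proof (rule Denjoy_Wolff_sequence[OF F nofix \<sigma> _ x(2)])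
      show "strict_mono (\<lambda>n. r (s n))"
        using strict_mono_o[OF r(1) s(2)] by (simp add: o_def)
      show "x \<longlonglongrightarrow> a" using s(3) by (simp add: x_def[abs_def] o_def)
      show "a \<in> ball 0 1" using s(1) K'(2) by blast
    qed
    moreover have "w n \<in> horodisc \<sigma> (B + 1)" for n
      using w[of n] horo_iter[OF x(2)[of n], of "r (s n)"] B(2)[OF x(1)[of n]]
      unfolding horodisc_iff_horo w_def by auto
    ultimately have "(\<lambda>n. h (w n)) \<longlonglongrightarrow> L"
      using w B(1) by (intro L[of w "B + 1"]) auto
    \<comment> \<open>Half of e, since the chordal distance is at most twice the Euclidean
      one.\<close>
    then have "\<forall>\<^sub>F n in sequentially. dist (h (w n)) L < e / 2"
      using \<open>e > 0\<close> by (intro tendstoD) auto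
    then obtain n where "dist (h (w n)) L < e / 2"
      using eventually_happens' sequentially_bot by blast
    then have "chordal_dist (Some (h (w n))) (Some L) < e"
      using chordal_dist_le[of "h (w n)" L] by (simp add: dist_norm del: chordal_dist.simps)
    moreover have "h (w n) = (f ^^ r (s n)) (y (s n))"
      unfolding w_def by (simp only: iter[OF x(2)] x(3))
    ultimately show False using y(2)[of "s n"] by simp
  qed
  ultimately show "\<exists>\<tau>\<in>riemann_sphere frontier_of (Some ` h ` ball 0 1).
      \<forall>K. compact K \<and> K \<subseteq> h ` ball 0 1 \<longrightarrow>
        (\<forall>\<epsilon>>0. \<forall>\<^sub>F n in sequentially. \<forall>z\<in>K. chordal_dist (Some ((f ^^ n) z)) \<tau> < \<epsilon>)"
    unfolding D_def by blast
qed

section \<open>Passage to an arbitrary Riemann map\<close>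

lemma disc_automorphism_Moebius:
  assumes \<phi>: "\<phi> holomorphic_on ball 0 1" "\<phi> ` ball 0 1 \<subseteq> ball 0 1"
    and \<psi>: "\<psi> holomorphic_on ball 0 1" "\<psi> ` ball 0 1 \<subseteq> ball 0 1"
    and inv: "\<And>z. z \<in> ball 0 1 \<Longrightarrow> \<psi> (\<phi> z) = z" "\<And>z. z \<in> ball 0 1 \<Longrightarrow> \<phi> (\<psi> z) = z"
  obtains c a where "cmod c = 1" "cmod a < 1"
    "\<And>z. z \<in> ball 0 1 \<Longrightarrow> \<phi> z = c * ((z - a) / (1 - cnj a * z))"
proof -
  define a where "a = \<psi> 0"
  have a: "cmod a < 1" "\<phi> a = 0"
    using \<psi>(2) inv(2)[of 0] by (force simp: a_def)+
  define M where "M = Moebius_function 0 a"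
  define N where "N = Moebius_function 0 (- a)"
  have M: "M holomorphic_on ball 0 1" "M ` ball 0 1 \<subseteq> ball 0 1"
    and N: "N holomorphic_on ball 0 1" "N ` ball 0 1 \<subseteq> ball 0 1"
    unfolding M_def N_def using a Moebius_function_norm_lt_1[of "- a" _ 0] Moebius_function_norm_lt_1[of a _ 0]
    by (auto intro!: Moebius_function_holomorphic)
  have NM: "N (M z) = z" "M (N z) = z" if "z \<in> ball 0 1" for z
    unfolding M_def N_def using a that by (auto intro!: Moebius_function_compose)
  have M0: "M a = 0" "N 0 = a"
    by (simp_all add: M_def N_def Moebius_function_def)
  have le: "cmod (k z) \<le> cmod z" if "k holomorphic_on ball 0 1" "k ` ball 0 1 \<subseteq> ball 0 1" "k 0 = 0" "cmod z < 1"
    for k z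
    using that(2,4) by (intro Schwarz_Lemma(1)[OF that(1,3)]) force+
  have hol: "(\<phi> \<circ> N) holomorphic_on ball 0 1" "(M \<circ> \<psi>) holomorphic_on ball 0 1"
    using \<phi> \<psi> M N by (auto intro: holomorphic_on_compose_gen)
  have into: "(\<phi> \<circ> N) ` ball 0 1 \<subseteq> ball 0 1" "(M \<circ> \<psi>) ` ball 0 1 \<subseteq> ball 0 1"
    unfolding image_comp[symmetric] using \<phi> \<psi> M N by blast+
  \<comment> \<open>The map and its inverse M \<circ> \<psi> both fix 0, so the Schwarz lemma in
    both directions gives equality of moduli. One nonzero point, here 1/2, suffices for its equality
    case.\<close>
  have "\<exists>\<alpha>. (\<forall>z. norm z < 1 \<longrightarrow> (\<phi> \<circ> N) z = \<alpha> * z) \<and> norm \<alpha> = 1"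
  proof (rule Schwarz_Lemma(3)[OF hol(1), where \<xi> = 0])
    show "(\<phi> \<circ> N) 0 = 0" using M0 a by simp
    show "cmod ((\<phi> \<circ> N) z) < 1" if "cmod z < 1" for z
      using into(1) that by force
    have h: "(1/2::complex) \<in> ball 0 1" by simp
    have w: "(\<phi> \<circ> N) (1/2) \<in> ball 0 1" using into(1) h by blast
    have "(M \<circ> \<psi>) ((\<phi> \<circ> N) (1/2)) = 1/2"
      using NM(2)[OF h] inv(1)[of "N (1/2)"] N(2) h by force
    moreover have "cmod ((M \<circ> \<psi>) ((\<phi> \<circ> N) (1/2))) \<le> cmod ((\<phi> \<circ> N) (1/2))"
      using w M0 by (intro le[OF hol(2) into(2)]) (auto simp: a_def)
    ultimately have "cmod (1/2) \<le> cmod ((\<phi> \<circ> N) (1/2))"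
      by (simp only:)
    moreover have "cmod ((\<phi> \<circ> N) (1/2)) \<le> cmod (1/2)"
      using le[OF hol(1) into(1), of "1/2"] M0 a by simp
    ultimately show "(\<exists>z. cmod z < 1 \<and> z \<noteq> 0 \<and> cmod ((\<phi> \<circ> N) z) = cmod z) \<or> cmod (deriv (\<phi> \<circ> N) 0) = 1"
      by (intro disjI1 exI[of _ "1/2"]) auto
  qed auto
  then obtain c where c: "\<And>z. cmod z < 1 \<Longrightarrow> \<phi> (N z) = c * z" "cmod c = 1"
    by auto
  have "\<phi> z = c * ((z - a) / (1 - cnj a * z))" if "z \<in> ball 0 1" for z
  proof -
    have "M z \<in> ball 0 1" using M(2) that by blast
    then have "\<phi> (N (M z)) = c * M z" using c(1) by simp
    then show ?thesis
      using NM(1)[OF that] by (simp add: M_def Moebius_function_simple)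
  qed
  with that[OF c(2) a(1)] show ?thesis by blast
qed

text \<open>An automorphism T multiplies \<open>horo\<close> by a factor independent of z, namely
  |T'(\<open>\<tau>\<close>)|, which is the quotient in the conclusion.\<close>

lemma Moebius_horodisc:
  assumes c: "cmod c = 1" and a: "cmod a < 1" and \<tau>: "cmod \<tau> = 1" and z: "z \<in> horodisc \<tau> R"
  defines "T \<equiv> \<lambda>z. c * ((z - a) / (1 - cnj a * z))"
  shows "T z \<in> horodisc (T \<tau>) (R * ((1 - (cmod a)\<^sup>2) / (cmod (1 - cnj a * \<tau>))\<^sup>2))"
proof -
  have zb: "z \<in> ball 0 1" "horo \<tau> z < R" using z by (auto simp: horodisc_iff_horo)
  have nz: "1 - cnj a * z \<noteq> 0" "1 - cnj a * \<tau> \<noteq> 0"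
    using a zb \<tau> one_minus_cnj_mult_nonzero[of a z] one_minus_cnj_mult_nonzero[of a \<tau>] by auto
  define A where "A = 1 - (cmod a)\<^sup>2"
  define B where "B = 1 - (cmod z)\<^sup>2"
  define p where "p = cmod (1 - cnj a * z)"
  define q where "q = cmod (1 - cnj a * \<tau>)"
  have pos: "A > 0" "B > 0" "p > 0" "q > 0"
    using a nz one_minus_norm_power2_pos[of a] one_minus_norm_power2_pos[OF zb(1)]
    unfolding A_def B_def p_def q_def by auto
  have "(\<tau> - a) / (1 - cnj a * \<tau>) - (z - a) / (1 - cnj a * z)
      = (\<tau> - z) * (1 - cnj a * a) / ((1 - cnj a * \<tau>) * (1 - cnj a * z))"
    using nz by (simp add: divide_simps) (simp add: algebra_simps)
  moreover have "1 - cnj a * a = of_real A"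
    unfolding A_def by (simp add: complex_norm_square mult.commute del: of_real_power)
  ultimately have "T \<tau> - T z = c * ((\<tau> - z) * of_real A / ((1 - cnj a * \<tau>) * (1 - cnj a * z)))"
    unfolding T_def right_diff_distrib[symmetric] by (simp only:)
  then have 1: "cmod (T \<tau> - T z) = cmod (\<tau> - z) * A / (q * p)"
    using pos by (simp add: c norm_mult norm_divide p_def q_def)
  have "cmod (T z) = cmod ((z - a) / (1 - cnj a * z))"
    by (simp only: T_def norm_mult c mult_1)
  then have 2: "1 - (cmod (T z))\<^sup>2 = A * B / p\<^sup>2"
    using one_minus_norm_Moebius[OF nz(1)] by (simp add: A_def B_def p_def)
  have "A * B / p\<^sup>2 > 0" using pos by simp
  then have "(cmod (T z))\<^sup>2 < 1\<^sup>2" unfolding 2[symmetric] by simp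
  then have Tz: "T z \<in> ball 0 1" by (simp add: power_less_one_iff)
  have "horo (T \<tau>) (T z) = (cmod (\<tau> - z))\<^sup>2 / B * (A / q\<^sup>2)"
    unfolding horo_def 1 2 using pos by (simp add: field_simps power2_eq_square)
  also have "\<dots> < R * (A / q\<^sup>2)"
    using zb(2) pos by (intro mult_strict_right_mono) (auto simp: horo_def B_def)
  finally show ?thesis
    using Tz by (simp add: horodisc_iff_horo A_def q_def)
qed

lemma horospheric_limits_compose_Moebius:
  assumes h: "horospheric_limits h" and c: "cmod c = 1" and a: "cmod a < 1"
    and k: "\<And>z. z \<in> ball 0 1 \<Longrightarrow> k z = h (c * ((z - a) / (1 - cnj a * z)))"
  shows "horospheric_limits k"
  unfolding horospheric_limits_def
proof
  fix \<tau> :: complex assume "\<tau> \<in> sphere 0 1"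
  then have \<tau>: "cmod \<tau> = 1" by simp
  define T where "T z = c * ((z - a) / (1 - cnj a * z))" for z
  have nz: "1 - cnj a * \<tau> \<noteq> 0"
    using a \<tau> by (intro one_minus_cnj_mult_nonzero) auto
  have aa: "1 - (cmod a)\<^sup>2 > 0"
    using a one_minus_norm_power2_pos[of a] by simp
  have Tb: "T z \<in> ball 0 1" if "z \<in> ball 0 1" for z
    using Moebius_function_norm_lt_1[OF a, of z 0] that
    by (simp add: T_def c norm_mult Moebius_function_simple norm_divide)
  have "(cmod ((\<tau> - a) / (1 - cnj a * \<tau>)))\<^sup>2 = 1"
    using one_minus_norm_Moebius[OF nz] \<tau> by simp
  then have "cmod ((\<tau> - a) / (1 - cnj a * \<tau>)) = 1"
    using norm_ge_zero[of "(\<tau> - a) / (1 - cnj a * \<tau>)"] unfolding power2_eq_1_iff by linarith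
  then have "cmod (T \<tau>) = 1"
    unfolding T_def norm_mult c by simp
  then obtain L where L: "\<And>z R. (\<forall>n. z n \<in> ball 0 1) \<Longrightarrow> z \<longlonglongrightarrow> T \<tau> \<Longrightarrow> R > 0 \<Longrightarrow>
      (\<forall>\<^sub>F n in sequentially. z n \<in> horodisc (T \<tau>) R) \<Longrightarrow> (\<lambda>n. h (z n)) \<longlonglongrightarrow> L"
    using h unfolding horospheric_limits_def by (metis mem_sphere_0)
  show "\<exists>L. \<forall>z R. (\<forall>n. z n \<in> ball 0 1) \<longrightarrow> z \<longlonglongrightarrow> \<tau> \<longrightarrow> R > 0 \<longrightarrow>
      (\<forall>\<^sub>F n in sequentially. z n \<in> horodisc \<tau> R) \<longrightarrow> (\<lambda>n. k (z n)) \<longlonglongrightarrow> L"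
  proof (intro exI[of _ L] allI impI)
    fix z R assume z: "\<forall>n. z n \<in> ball 0 1" "z \<longlonglongrightarrow> \<tau>" "R > 0"
      "\<forall>\<^sub>F n in sequentially. z n \<in> horodisc \<tau> R"
    have "(\<lambda>n. h (T (z n))) \<longlonglongrightarrow> L"
    proof (rule L)
      show "\<forall>n. T (z n) \<in> ball 0 1" using Tb z(1) by blast
      show "(\<lambda>n. T (z n)) \<longlonglongrightarrow> T \<tau>"
        unfolding T_def by (intro tendsto_intros z nz)
      show "\<forall>\<^sub>F n in sequentially. T (z n) \<in> horodisc (T \<tau>) (R * ((1 - (cmod a)\<^sup>2) / (cmod (1 - cnj a * \<tau>))\<^sup>2))"
        using z(4) by eventually_elim (unfold T_def, rule Moebius_horodisc[OF c a \<tau>])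
      show "R * ((1 - (cmod a)\<^sup>2) / (cmod (1 - cnj a * \<tau>))\<^sup>2) > 0"
        using z(3) aa nz by (intro mult_pos_pos divide_pos_pos) auto
    qed
    then show "(\<lambda>n. k (z n)) \<longlonglongrightarrow> L"
      using k z(1) by (simp add: T_def)
  qed
qed

text \<open>With g the inverse of h, the map g \<circ> k is an automorphism of the disc and k = h
  \<circ> (g \<circ> k).\<close>

lemma horospheric_limits_riemann_map:
  assumes h: "h holomorphic_on ball 0 1" "inj_on h (ball 0 1)" "horospheric_limits h"
    and k: "riemann_map k (h ` ball 0 1)"
  shows "horospheric_limits k"
proof -
  define D where "D = h ` ball 0 1"
  obtain g where g: "g holomorphic_on D" "\<And>z. z \<in> ball 0 1 \<Longrightarrow> g (h z) = z"
    using holomorphic_has_inverse[OF h(1) open_ball h(2)] unfolding D_def by metis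
  have hg: "h (g y) = y" "g y \<in> ball 0 1" if "y \<in> D" for y
    using that g(2) by (auto simp: D_def)
  define l where "l = inv_into (ball 0 1) k"
  have k': "k holomorphic_on ball 0 1" "bij_betw k (ball 0 1) D" "l holomorphic_on D"
    using k by (auto simp: riemann_map_def D_def l_def)
  have kD: "k z \<in> D" if "z \<in> ball 0 1" for z
    using k'(2) that by (auto simp: bij_betw_def)
  have hD: "h z \<in> D" if "z \<in> ball 0 1" for z
    using that by (simp add: D_def)
  have l: "l (k z) = z" if "z \<in> ball 0 1" for z
    using k'(2) that by (simp add: l_def bij_betw_def)
  have kl: "k (l y) = y" "l y \<in> ball 0 1" if "y \<in> D" for y
    using k'(2) that l by (auto simp: bij_betw_def)
  have "(g \<circ> k) holomorphic_on ball 0 1" "(l \<circ> h) holomorphic_on ball 0 1"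
    using kD hD by (auto intro!: holomorphic_on_compose_gen[OF k'(1) g(1)] holomorphic_on_compose_gen[OF h(1) k'(3)])
  moreover have "(g \<circ> k) ` ball 0 1 \<subseteq> ball 0 1" "(l \<circ> h) ` ball 0 1 \<subseteq> ball 0 1"
    unfolding o_def using hg(2)[OF kD] kl(2)[OF hD] by blast+
  moreover have "(l \<circ> h) ((g \<circ> k) z) = z" "(g \<circ> k) ((l \<circ> h) z) = z" if "z \<in> ball 0 1" for z
    using that by (simp_all only: o_apply hg(1)[OF kD] kl(1)[OF hD] l g(2))
  ultimately obtain c a where "cmod c = 1" "cmod a < 1"
    "\<And>z. z \<in> ball 0 1 \<Longrightarrow> (g \<circ> k) z = c * ((z - a) / (1 - cnj a * z))"
    using disc_automorphism_Moebius[of "g \<circ> k" "l \<circ> h"] by metis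
  moreover have "k z = h ((g \<circ> k) z)" if "z \<in> ball 0 1" for z
    using hg(1)[OF kD[OF that]] by simp
  ultimately show ?thesis
    using horospheric_limits_compose_Moebius[OF h(3)] by metis
qed

section \<open>Nontangential limits and the obstruction to continuous extension\<close>

lemma stolz_region_subset_horodisc:
  assumes "M > 1"
  shows "stolz_region \<sigma> M \<subseteq> horodisc \<sigma> (M\<^sup>2)"
proof
  fix z assume "z \<in> stolz_region \<sigma> M"
  then have z: "z \<in> ball 0 1" "cmod z < 1" "cmod (\<sigma> - z) < M * (1 - cmod z)"
    by (auto simp: stolz_region_def)
  have "(cmod (\<sigma> - z))\<^sup>2 < (M * (1 - cmod z))\<^sup>2"
    using z by (intro power_strict_mono) auto
  also have "\<dots> = M\<^sup>2 * ((1 - cmod z) * (1 - cmod z))"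
    by (simp add: power2_eq_square)
  also have "\<dots> \<le> M\<^sup>2 * ((1 - cmod z) * (1 + cmod z))"
    using z assms by (intro mult_left_mono) auto
  also have "(1 - cmod z) * (1 + cmod z) = 1 - (cmod z)\<^sup>2"
    by (simp add: power2_eq_square algebra_simps)
  finally have "(cmod (\<sigma> - z))\<^sup>2 < M\<^sup>2 * (1 - (cmod z)\<^sup>2)" .
  then show "z \<in> horodisc \<sigma> (M\<^sup>2)"
    using z(1) one_minus_norm_power2_pos[OF z(1)] by (simp add: horodisc_def field_simps)
qed

lemma limits_if_horospheric_limits:
  assumes "horospheric_limits h" "\<sigma> \<in> sphere 0 1"
  shows "\<exists>L. has_H_limit h L \<sigma> \<and> has_nontangential_limit h L \<sigma>"
proof -
  obtain L where L: "\<And>z R. (\<forall>n. z n \<in> ball 0 1) \<Longrightarrow> z \<longlonglongrightarrow> \<sigma> \<Longrightarrow> R > 0 \<Longrightarrow>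
      (\<forall>\<^sub>F n in sequentially. z n \<in> horodisc \<sigma> R) \<Longrightarrow> (\<lambda>n. h (z n)) \<longlonglongrightarrow> L"
    using assms unfolding horospheric_limits_def by metis
  have "has_H_limit h (Some L) \<sigma>"
    unfolding has_H_limit_def by (auto intro!: limitin_riemann_sphere_Some L)
  moreover have "has_nontangential_limit h (Some L) \<sigma>"
    unfolding has_nontangential_limit_def
  proof (intro allI impI limitin_riemann_sphere_Some)
    fix M :: real assume M: "M > 1"
    show "(h \<longlongrightarrow> L) (at \<sigma> within stolz_region \<sigma> M)"
      unfolding tendsto_at_iff_sequentially
    proof (intro allI impI)
      fix z assume z: "\<forall>n. z n \<in> stolz_region \<sigma> M - {\<sigma>}" "z \<longlonglongrightarrow> \<sigma>"
      have "z n \<in> horodisc \<sigma> (M\<^sup>2)" for n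
        using z(1) stolz_region_subset_horodisc[OF M, of \<sigma>] by blast
      moreover have "M\<^sup>2 > 0" using M by simp
      ultimately show "(h \<circ> z) \<longlonglongrightarrow> L"
        unfolding o_def using z(2) by (intro L[of z "M\<^sup>2"]) (auto simp: horodisc_def)
    qed
  qed
  ultimately show ?thesis by blast
qed

text \<open>The easy half of Caratheodory's theorem, used in contrapositive form. The extension maps
  the circle onto the frontier; by compactness this is a quotient map, and quotient maps preserve
  local connectedness.\<close>

lemma locally_connected_frontier_if_extends:
  assumes k: "riemann_map k D" and "open D"
    and g: "continuous_on (cball 0 1) g" "\<And>z. z \<in> ball 0 1 \<Longrightarrow> g z = k z"
  shows "locally connected (frontier D)"
proof -
  define l where "l = inv_into (ball 0 1) k"
  have k': "bij_betw k (ball 0 1) D" "continuous_on D l"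
    using k by (auto simp: riemann_map_def l_def intro: holomorphic_on_imp_continuous_on)
  have l: "l (k z) = z" if "z \<in> ball 0 1" for z
    using k'(1) that by (simp add: l_def bij_betw_def)
  have D: "D = g ` ball 0 1"
    using k'(1) g(2) by (auto simp: bij_betw_def)
  have "compact (g ` cball 0 1)"
    using g(1) by (intro compact_continuous_image) auto
  then have "closure D \<subseteq> g ` cball 0 1"
    unfolding D by (intro closure_minimal compact_imp_closed image_mono) auto
  moreover have "g ` cball 0 1 \<subseteq> closure D"
    unfolding D using g(1) image_closure_subset[of "ball 0 1" g "closure (g ` ball 0 1)"]
    by (simp add: closure_subset)
  ultimately have cl: "closure D = g ` cball 0 1" by blast
  \<comment> \<open>A boundary value inside D would, by continuity of the inverse l along a radius,
    force l (g \<open>\<zeta>\<close>) = \<open>\<zeta>\<close>, but l takes values in the open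
    disc.\<close>
  have "g \<zeta> \<notin> D" if \<zeta>: "\<zeta> \<in> sphere 0 1" for \<zeta>
  proof
    assume gD: "g \<zeta> \<in> D"
    define r where "r n = 1 - inverse (real (Suc n))" for n
    have r: "0 \<le> r n" "r n < 1" for n
      by (auto simp: r_def field_simps)
    have "r \<longlonglongrightarrow> 1 - 0"
      unfolding r_def by (intro tendsto_intros LIMSEQ_inverse_real_of_nat)
    then have rz: "(\<lambda>n. of_real (r n) * \<zeta>) \<longlonglongrightarrow> of_real 1 * \<zeta>"
      by (intro tendsto_intros) simp
    have rb: "of_real (r n) * \<zeta> \<in> ball 0 1" for n
      using r[of n] \<zeta> by (simp add: norm_mult)
    have "(\<lambda>n. g (of_real (r n) * \<zeta>)) \<longlonglongrightarrow> g (of_real 1 * \<zeta>)"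
      using rb \<zeta> by (intro continuous_on_tendsto_compose[OF g(1) rz]) (auto simp: less_imp_le)
    then have "(\<lambda>n. k (of_real (r n) * \<zeta>)) \<longlonglongrightarrow> g \<zeta>"
      using g(2)[OF rb] by simp
    then have "(\<lambda>n. l (k (of_real (r n) * \<zeta>))) \<longlonglongrightarrow> l (g \<zeta>)"
      using k'(1) rb by (intro continuous_on_tendsto_compose[OF k'(2) _ gD] always_eventually allI)
        (auto simp: bij_betw_def simp del: mem_ball)
    then have "(\<lambda>n. of_real (r n) * \<zeta>) \<longlonglongrightarrow> l (g \<zeta>)"
      using l[OF rb] by simp
    then have "l (g \<zeta>) = \<zeta>"
      using rz LIMSEQ_unique by fastforce
    moreover have "l (g \<zeta>) \<in> ball 0 1"
      using gD k'(1) l by (auto simp: bij_betw_def simp del: mem_ball)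
    ultimately show False using \<zeta> by simp
  qed
  moreover have "frontier D = closure D - D"
    using \<open>open D\<close> by (simp add: frontier_def interior_open)
  moreover have "cball (0::complex) 1 = ball 0 1 \<union> sphere 0 1"
    by auto
  ultimately have fr: "frontier D = g ` sphere 0 1"
    using cl D by blast
  show ?thesis
    unfolding fr
  proof (rule locally_connected_quotient_image[OF locally_connected_sphere])
    fix T assume "T \<subseteq> g ` sphere 0 1"
    then show "openin (top_of_set (sphere 0 1)) (sphere 0 1 \<inter> g -` T) = openin (top_of_set (g ` sphere 0 1)) T"
      by (intro Abstract_Topology_2.continuous_imp_quotient_map[OF continuous_on_subset[OF g(1)] refl compact_sphere]) auto
  qed
qed

theorem proposition1p5:
  shows "\<exists>D :: complex set.
    open D \<and> connected D \<and> D \<noteq> {} \<and> simply_connected D \<and> bounded D \<and>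
    denjoy_wolff_property D \<and>
    \<not> locally connected (frontier D) \<and>
    (\<forall>h. riemann_map h D \<longrightarrow>
       \<not> (\<exists>g. continuous_on (cball 0 1) g \<and> (\<forall>z\<in>ball 0 1. g z = h z)) \<and>
       (\<forall>\<sigma>\<in>sphere 0 1. \<exists>L. has_H_limit h L \<sigma> \<and> has_nontangential_limit h L \<sigma>))"
proof -
  have inj: "inj_on comb_map (ball 0 1)"
    using inj_on_comb_map by (rule inj_on_subset) auto
  have lims: "horospheric_limits comb_map"
    unfolding horospheric_limits_def using comb_map_horodisc_tendsto by blast
  have cont: "continuous_on (ball 0 1) comb_map"
    using holomorphic_comb_map by (rule holomorphic_on_imp_continuous_on)
  obtain g where g: "g holomorphic_on comb_domain" "\<And>z. z \<in> ball 0 1 \<Longrightarrow> g (comb_map z) = z"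
    using holomorphic_has_inverse[OF holomorphic_comb_map open_ball inj]
    unfolding comb_domain_def by metis
  have "ball (0::complex) 1 homeomorphic comb_domain"
    unfolding homeomorphic_minimal
  proof (intro exI conjI ballI)
    show "continuous_on (ball 0 1) comb_map" "continuous_on comb_domain g"
      using cont holomorphic_on_imp_continuous_on[OF g(1)] .
  qed (use g(2) in \<open>auto simp: comb_domain_def\<close>)
  moreover have "simply_connected (ball (0::complex) 1)"
    by (intro convex_imp_simply_connected) auto
  ultimately have sc: "simply_connected comb_domain"
    using homeomorphic_simply_connected by blast
  have "bounded comb_domain"
    unfolding comb_domain_def by (rule bounded_subset[OF bounded_comb_map]) auto
  moreover have "comb_domain \<noteq> {}"
    by (simp add: comb_domain_def)
  moreover have "denjoy_wolff_property comb_domain"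
    unfolding comb_domain_def
    using holomorphic_comb_map inj lims by (rule denjoy_wolff_property_if_horospheric_limits)
  moreover have "\<not> (\<exists>g. continuous_on (cball 0 1) g \<and> (\<forall>z\<in>ball 0 1. g z = k z))"
    if "riemann_map k comb_domain" for k
    using locally_connected_frontier_if_extends[OF that open_comb_domain]
      not_locally_connected_frontier_comb_domain by blast
  moreover have "\<exists>L. has_H_limit k L \<sigma> \<and> has_nontangential_limit k L \<sigma>"
    if "riemann_map k comb_domain" "\<sigma> \<in> sphere 0 1" for k \<sigma>
    using horospheric_limits_riemann_map[OF holomorphic_comb_map inj lims] that
    by (intro limits_if_horospheric_limits) (auto simp: comb_domain_def)
  ultimately show ?thesis
    using open_comb_domain sc simply_connected_imp_connected[OF sc]
      not_locally_connected_frontier_comb_domain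
    by (intro exI[of _ comb_domain]) blast
qed

end
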